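(* Let $\Omega\subset\mathbb C^n$ be a bounded domain. For every $z\in\Omega$ and every $X=\sum_j X_j\,\partial/\partial z_j$ with $(X_1,\dots,X_n)\in\mathbb C^n$, one has $B_p(z;X)\to C(z;X)$ as $p\to\infty$.
   Context: For $p>0$, $A^p(\Omega)$ is the space of holomorphic functions $f$ on $\Omega$ with $\|f\|_p^p:=\int_\Omega|f|^p<\infty$ (Lebesgue measure); $A^\infty(\Omega)$ is the space of bounded holomorphic functions with the sup norm $\|\cdot\|_\infty$. Put $m_p(z):=\inf\{\|f\|_p: f\in A^p(\Omega),\ f(z)=1\}$ and $K_p(z):=m_p(z)^{-p}$. Write $Xf=\sum_jX_j\,\partial f/\partial z_j$. The $p$-Bergman metric is $B_p(z;X):=K_p(z)^{-1/p}\cdot\sup\{|Xf(z)|: f\in A^p(\Omega),\ f(z)=0,\ \|f\|_p=1\}$, and the Carathéodory metric is $C(z;X):=\sup\{|Xf(z)|: f\in A^\infty(\Omega),\ f(z)=0,\ \|f\|_\infty=1\}$. *)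

theory Defs
  imports "HOL-Analysis.Analysis"
begin

(* Complex Frechet differentiability at every point.  Only used for open \<Omega>, where no value
   of f outside \<Omega> matters. *)
definition holomorphic_Cn :: "((complex ^ 'n) \<Rightarrow> complex) \<Rightarrow> (complex ^ 'n) set \<Rightarrow> bool" where
  "holomorphic_Cn f \<Omega> \<longleftrightarrow>
     (\<forall>z\<in>\<Omega>. \<exists>f'. (f has_derivative f') (at z) \<and> (\<forall>c v. f' (c *s v) = c * f' v))"

definition partial_deriv :: "'n \<Rightarrow> ((complex ^ 'n) \<Rightarrow> complex) \<Rightarrow> complex ^ 'n \<Rightarrow> complex" where
  "partial_deriv j f z = deriv (\<lambda>w. f (\<chi> i. if i = j then w else z $ i)) (z $ j)"

definition vector_deriv :: "complex ^ 'n \<Rightarrow> ((complex ^ 'n) \<Rightarrow> complex) \<Rightarrow> complex ^ 'n \<Rightarrow> complex" where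
  "vector_deriv X f z = (\<Sum>j\<in>UNIV. X $ j * partial_deriv j f z)"

definition Lp_norm :: "real \<Rightarrow> (complex ^ 'n) set \<Rightarrow> ((complex ^ 'n) \<Rightarrow> complex) \<Rightarrow> real" where
  "Lp_norm p \<Omega> f = (set_lebesgue_integral lebesgue \<Omega> (\<lambda>z. norm (f z) powr p)) powr (1 / p)"

definition bergman_space :: "real \<Rightarrow> (complex ^ 'n) set \<Rightarrow> ((complex ^ 'n) \<Rightarrow> complex) set" where
  "bergman_space p \<Omega> =
     {f. holomorphic_Cn f \<Omega> \<and> set_integrable lebesgue \<Omega> (\<lambda>z. norm (f z) powr p)}"

definition sup_norm :: "(complex ^ 'n) set \<Rightarrow> ((complex ^ 'n) \<Rightarrow> complex) \<Rightarrow> real" where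
  "sup_norm \<Omega> f = (SUP z\<in>\<Omega>. norm (f z))"

definition bounded_holomorphic :: "(complex ^ 'n) set \<Rightarrow> ((complex ^ 'n) \<Rightarrow> complex) set" where
  "bounded_holomorphic \<Omega> = {f. holomorphic_Cn f \<Omega> \<and> bounded (f ` \<Omega>)}"

(* The infima and suprema below are taken in the conditionally complete type real.  For a bounded
   domain \<Omega>, z \<in> \<Omega> and p > 0 the sets in question are nonempty (normalised constants and
   coordinate functions) and bounded (nonnegativity, resp. Cauchy estimates), so they are the usual
   ones. *)
definition bergman_min :: "real \<Rightarrow> (complex ^ 'n) set \<Rightarrow> complex ^ 'n \<Rightarrow> real" where
  "bergman_min p \<Omega> z = Inf {Lp_norm p \<Omega> f | f. f \<in> bergman_space p \<Omega> \<and> f z = 1}"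

definition bergman_kernel :: "real \<Rightarrow> (complex ^ 'n) set \<Rightarrow> complex ^ 'n \<Rightarrow> real" where
  "bergman_kernel p \<Omega> z = bergman_min p \<Omega> z powr (- p)"

definition bergman_metric ::
    "real \<Rightarrow> (complex ^ 'n) set \<Rightarrow> complex ^ 'n \<Rightarrow> complex ^ 'n \<Rightarrow> real" where
  "bergman_metric p \<Omega> z X =
     bergman_kernel p \<Omega> z powr (- 1 / p) *
     Sup {norm (vector_deriv X f z) | f. f \<in> bergman_space p \<Omega> \<and> f z = 0 \<and> Lp_norm p \<Omega> f = 1}"

definition caratheodory_metric ::
    "(complex ^ 'n) set \<Rightarrow> complex ^ 'n \<Rightarrow> complex ^ 'n \<Rightarrow> real" where
  "caratheodory_metric \<Omega> z X =
     Sup {norm (vector_deriv X f z) | f.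
            f \<in> bounded_holomorphic \<Omega> \<and> f z = 0 \<and> sup_norm \<Omega> f = 1}"

end

theory Submission
  imports Defs "HOL-Complex_Analysis.Complex_Analysis"
begin

text \<open>Write \<open>m p\<close> for \<^const>\<open>bergman_min\<close> and \<open>S p\<close> for the supremum of
  \<open>\<bar>X f(z)\<bar>\<close> over the functions in the unit sphere of the Bergman space that vanish at \<open>z\<close>, so that the
  \<open>p\<close>-Bergman metric is the product \<open>m p * S p\<close>. We show \<open>m p \<longlongrightarrow> 1\<close> and that \<open>S p\<close> tends to the
  Caratheodory metric \<open>C\<close>.

  Everything rests on comparing the two norms up to a factor of the form \<open>c powr (1 / p)\<close>, which
  tends to \<open>1\<close>. In one direction, a function bounded by \<open>B\<close> has \<open>p\<close>-norm at most
  \<open>B * vol \<Omega> powr (1 / p)\<close> (\<open>bounded_holomorphic_in_bergman_space\<close>). In the other, for \<open>p \<ge> 1\<close>, \<open>\<bar>f\<bar> powr p\<close> satisfies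
  the sub-mean value inequality on balls, hence
  \<open>\<bar>f w\<bar> \<le> vol (ball 0 r) powr (- 1 / p) * \<parallel>f\<parallel>\<close> whenever \<open>ball w r \<subseteq> \<Omega>\<close>
  (\<open>pointwise_bound_bergman\<close>). Testing with the constant \<open>1\<close> squeezes \<open>m p\<close> between
  \<open>vol (ball 0 r) powr (1 / p)\<close> and \<open>vol \<Omega> powr (1 / p)\<close>. Rescaling the competitors for \<open>C\<close> to \<open>p\<close>-norm
  one gives \<open>C \<le> vol \<Omega> powr (1 / p) * S p\<close>, the lower bound for \<open>S p\<close>.

  The upper bound for \<open>S p\<close> is a normal families argument. If \<open>S p\<close> exceeded some \<open>b > C\<close> for
  arbitrarily large \<open>p\<close>, there would be functions \<open>f k\<close> vanishing at \<open>z\<close> with \<open>\<bar>X f k(z)\<bar> \<ge> b\<close>, of \<open>p k\<close>-norm one with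
  \<open>p k \<longlonglongrightarrow> \<infinity>\<close>. By the pointwise bound they are locally uniformly bounded, so a subsequence converges,
  together with its derivatives, to a holomorphic \<open>g\<close> (\<open>Montel_Cn\<close>). The same bound, whose constant tends
  to \<open>1\<close>, gives \<open>\<bar>g\<bar> \<le> 1\<close> on \<open>\<Omega>\<close>; also \<open>g z = 0\<close>, so \<open>b \<le> \<bar>X g(z)\<bar> \<le> C\<close>, a contradiction.

  Derivatives are handled along complex lines: the restriction of a holomorphic function to a
  line is holomorphic in one variable, and this transports Cauchy's estimate and the mean value
  property. Averaging the latter over the directions in a ball requires that Lebesgue measure on
  \<open>\<complex>\<^sup>n\<close> is invariant under multiplication by unit scalars.\<close>

section \<open>Complex differentiability along complex lines\<close>

lemma norm_vector_scalar_mult: "norm (c *s v) = cmod c * norm (v :: complex ^ 'n)"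
  by (simp add: norm_vec_def norm_mult L2_set_right_distrib)

lemma bounded_linear_vector_scalar_mult_left:
  "bounded_linear (\<lambda>c. c *s (v :: complex ^ 'n))"
  by (rule bounded_linear_intro[where K = "norm v"])
     (auto simp: vec_eq_iff algebra_simps norm_vector_scalar_mult)

lemma bounded_linear_vector_scalar_mult_right:
  "bounded_linear (\<lambda>v :: complex ^ 'n. c *s v)"
  by (rule bounded_linear_intro[where K = "cmod c"])
     (auto simp: vec_eq_iff algebra_simps norm_vector_scalar_mult)

lemma holomorphic_CnD:
  assumes "holomorphic_Cn f S" "x \<in> S"
  shows "(f has_derivative frechet_derivative f (at x)) (at x)"
    and "frechet_derivative f (at x) (c *s v) = c * frechet_derivative f (at x) v"
proof -
  obtain f' where f': "(f has_derivative f') (at x)" "\<And>c v. f' (c *s v) = c * f' v"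
    using assms unfolding holomorphic_Cn_def by blast
  with frechet_derivative_at[OF f'(1)]
  show "(f has_derivative frechet_derivative f (at x)) (at x)"
    and "frechet_derivative f (at x) (c *s v) = c * frechet_derivative f (at x) v"
    by simp_all
qed

lemma holomorphic_Cn_continuous_on:
  "holomorphic_Cn f S \<Longrightarrow> continuous_on S f"
  by (meson continuous_at_imp_continuous_on has_derivative_continuous holomorphic_CnD(1))

lemma holomorphic_Cn_subset: "holomorphic_Cn f S \<Longrightarrow> T \<subseteq> S \<Longrightarrow> holomorphic_Cn f T"
  unfolding holomorphic_Cn_def by blast

lemma has_field_derivative_along_line:
  assumes "holomorphic_Cn f S" "a + \<zeta> *s v \<in> S"
  shows "((\<lambda>\<zeta>. f (a + \<zeta> *s v)) has_field_derivative
           frechet_derivative f (at (a + \<zeta> *s v)) v) (at \<zeta>)"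
proof -
  have "((\<lambda>\<zeta>. a + \<zeta> *s v) has_derivative (\<lambda>h. h *s v)) (at \<zeta>)"
    using bounded_linear_imp_has_derivative[OF bounded_linear_vector_scalar_mult_left]
    by (auto intro!: derivative_eq_intros)
  from has_derivative_compose[OF this holomorphic_CnD(1)[OF assms]]
  show ?thesis
    by (simp add: has_field_derivative_def holomorphic_CnD(2)[OF assms] mult.commute[of _ "frechet_derivative f _ v"])
qed

lemma holomorphic_on_line:
  assumes "holomorphic_Cn f S" "\<And>\<zeta>. \<zeta> \<in> T \<Longrightarrow> a + \<zeta> *s v \<in> S"
  shows "(\<lambda>\<zeta>. f (a + \<zeta> *s v)) holomorphic_on T"
  unfolding holomorphic_on_def field_differentiable_def
  using has_field_derivative_along_line[OF assms(1)] assms(2) DERIV_subset by blast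

text \<open>The coordinate slice defining a partial derivative is a complex line in the direction of a
  basis vector, and complex linearity of the derivative reassembles these directions into \<open>X\<close>.\<close>
lemma vector_deriv_eq_frechet_derivative:
  assumes "holomorphic_Cn f S" "z \<in> S"
  shows "vector_deriv X f z = frechet_derivative f (at z) X"
proof -
  let ?D = "frechet_derivative f (at z)"
  interpret D: bounded_linear ?D
    using holomorphic_CnD(1)[OF assms] has_derivative_bounded_linear by blast
  have pd: "partial_deriv j f z = ?D (axis j 1)" for j
  proof -
    have eq: "(\<lambda>w. f (\<chi> i. if i = j then w else z $ i)) =
          (\<lambda>w. f ((\<chi> i. if i = j then 0 else z $ i) + w *s axis j 1))"
      by (intro ext arg_cong[of _ _ f]) (auto simp: vec_eq_iff axis_def)
    have z: "(\<chi> i. if i = j then 0 else z $ i) + z $ j *s axis j 1 = z"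
      by (auto simp: vec_eq_iff axis_def)
    have "((\<lambda>w. f ((\<chi> i. if i = j then 0 else z $ i) + w *s axis j 1)) has_field_derivative
        ?D (axis j 1)) (at (z $ j))"
      using has_field_derivative_along_line[OF assms(1), of "\<chi> i. if i = j then 0 else z $ i"
          "z $ j" "axis j 1", unfolded z] assms(2) by blast
    then show ?thesis
      unfolding partial_deriv_def eq by (rule DERIV_imp_deriv)
  qed
  have "?D X = ?D (\<Sum>j\<in>UNIV. X $ j *s axis j 1)"
    by (intro arg_cong[of _ _ ?D]) (simp add: vec_eq_iff axis_def if_distrib cong: if_cong)
  also have "\<dots> = (\<Sum>j\<in>UNIV. X $ j * ?D (axis j 1))"
    by (simp only: D.sum holomorphic_CnD(2)[OF assms])
  finally show ?thesis by (simp add: vector_deriv_def pd)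
qed

text \<open>The derivative in the direction \<open>v\<close> is the one-variable derivative at \<open>0\<close> of \<open>\<zeta> \<mapsto> f (x + \<zeta> v)\<close>, a
  function on the disc of radius \<open>r / \<parallel>v\<parallel>\<close>; the one-variable estimate on slightly smaller closed discs
  yields the bound in the limit.\<close>
lemma Cauchy_estimate_frechet:
  assumes f: "holomorphic_Cn f (ball x r)" and r: "r > 0"
    and M: "\<And>y. y \<in> ball x r \<Longrightarrow> norm (f y) \<le> M"
  shows "norm (frechet_derivative f (at x) v) \<le> M / r * norm v"
proof (cases "v = 0")
  case True
  interpret D: bounded_linear "frechet_derivative f (at x)"
    using holomorphic_CnD(1)[OF f] r has_derivative_bounded_linear by (metis centre_in_ball)
  show ?thesis using True D.zero by simp
next
  case False
  let ?\<phi> = "\<lambda>\<zeta>. f (x + \<zeta> *s v)"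
  have in_ball: "x + \<zeta> *s v \<in> ball x r" if "norm \<zeta> < r / norm v" for \<zeta>
    using that False by (simp add: dist_norm norm_vector_scalar_mult field_simps)
  have D: "deriv ?\<phi> 0 = frechet_derivative f (at x) v"
    using has_field_derivative_along_line[OF f, of x 0 v] r by (simp add: DERIV_imp_deriv)
  have hol: "?\<phi> holomorphic_on ball 0 (r / norm v)"
    by (rule holomorphic_on_line[OF f]) (use in_ball in auto)
  have bound: "norm (frechet_derivative f (at x) v) \<le> M / s" if s: "0 < s" "s < r / norm v" for s
  proof -
    have "norm ((deriv ^^ 1) ?\<phi> 0) \<le> fact 1 * M / s ^ 1"
    proof (rule Cauchy_inequality)
      show "?\<phi> holomorphic_on ball 0 s"
        by (rule holomorphic_on_subset[OF hol]) (use s in auto)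
      show "continuous_on (cball 0 s) ?\<phi>"
        by (rule continuous_on_subset[OF holomorphic_on_imp_continuous_on[OF hol]]) (use s in auto)
      show "norm (?\<phi> \<zeta>) \<le> M" if "norm (0 - \<zeta>) = s" for \<zeta>
        using M[OF in_ball] that s by auto
    qed (use s in auto)
    then show ?thesis by (simp add: D)
  qed
  have "((\<lambda>s. M / s) \<longlongrightarrow> M / (r / norm v)) (at_left (r / norm v))"
    using False r by (intro tendsto_intros) auto
  moreover have "\<forall>\<^sub>F s in at_left (r / norm v). norm (frechet_derivative f (at x) v) \<le> M / s"
    unfolding eventually_at_left_field using bound False r
    by (intro exI[of _ 0]) auto
  ultimately have "norm (frechet_derivative f (at x) v) \<le> M / (r / norm v)"
    by (intro tendsto_lowerbound[where F = "at_left (r / norm v)"]) auto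
  then show ?thesis by simp
qed

section \<open>The sub-mean value inequality on balls\<close>

text \<open>Isometries preserve Lebesgue measure by uniqueness of translation-invariant measures: the image
  measure \<open>\<mu>\<close> is translation invariant, and evaluating \<open>\<integral>\<integral> 1\<^sub>A(x) 1\<^sub>B(y - x) dx d\<mu>(y)\<close> in both orders, with \<open>B\<close>
  the unit ball, gives \<open>\<lambda>(A) \<mu>(B) = \<mu>(A) \<lambda>(B)\<close>. The ball is preserved by the isometry, so both factors
  belonging to \<open>B\<close> agree and cancel.\<close>
lemma distr_lborel_orthogonal_transformation:
  fixes T :: "'a::euclidean_space \<Rightarrow> 'a"
  assumes T: "orthogonal_transformation T"
  shows "distr lborel borel T = lborel"
proof (rule measure_eqI)
  let ?T' = "inv T"
  have lin: "linear T" and bij: "bij T" and norm_T: "\<And>x. norm (T x) = norm x"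
    using T by (simp_all add: orthogonal_transformation_linear orthogonal_transformation_bij
        orthogonal_transformation_norm)
  have TT': "T (?T' x) = x" for x
    using bij by (simp add: bij_is_surj surj_f_inv_f)
  have [measurable]: "T \<in> borel_measurable borel"
    using lin by (intro borel_measurable_continuous_onI linear_continuous_on)
      (simp add: linear_conv_bounded_linear)
  fix A assume "A \<in> sets (distr lborel borel T)"
  then have A[measurable]: "A \<in> sets borel" by simp
  define a where "a = (indicator A :: 'a \<Rightarrow> ennreal)"
  define b where "b = (indicator (ball 0 1) :: 'a \<Rightarrow> ennreal)"
  define \<beta> where "\<beta> = (\<integral>\<^sup>+y. b y \<partial>lborel)"
  have [measurable]: "a \<in> borel_measurable borel" "b \<in> borel_measurable borel"
    unfolding a_def b_def by (auto intro!: borel_measurable_indicator)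
  have shift: "(\<integral>\<^sup>+y. f y \<partial>lborel) = (\<integral>\<^sup>+y. f (c + y) \<partial>lborel)"
    if [measurable]: "f \<in> borel_measurable borel" for f :: "'a \<Rightarrow> ennreal" and c
    by (subst lborel_distr_plus[of c, symmetric], subst nn_integral_distr) auto
  have "emeasure lborel A * \<beta> = (\<integral>\<^sup>+x. a x * \<beta> \<partial>lborel)"
    by (simp add: nn_integral_multc a_def)
  also have "\<dots> = (\<integral>\<^sup>+x. \<integral>\<^sup>+y. a x * b (T y - x) \<partial>lborel \<partial>lborel)"
  proof (rule nn_integral_cong)
    fix x :: 'a
    have "(\<integral>\<^sup>+y. b (T y - x) \<partial>lborel) = (\<integral>\<^sup>+y. b (T (?T' x + y) - x) \<partial>lborel)"
      by (rule shift) measurable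
    also have "\<dots> = \<beta>"
      unfolding \<beta>_def
      by (intro nn_integral_cong) (simp add: linear_add[OF lin] TT' b_def indicator_def norm_T)
    finally show "a x * \<beta> = (\<integral>\<^sup>+y. a x * b (T y - x) \<partial>lborel)"
      by (simp add: nn_integral_cmult)
  qed
  also have "\<dots> = (\<integral>\<^sup>+y. \<integral>\<^sup>+x. a x * b (T y - x) \<partial>lborel \<partial>lborel)"
    by (rule lborel_pair.Fubini') measurable
  also have "\<dots> = (\<integral>\<^sup>+y. \<integral>\<^sup>+u. a (T y + u) * b u \<partial>lborel \<partial>lborel)"
  proof (rule nn_integral_cong)
    fix y :: 'a
    have "(\<integral>\<^sup>+x. a x * b (T y - x) \<partial>lborel) =
        (\<integral>\<^sup>+u. a (T y + u) * b (T y - (T y + u)) \<partial>lborel)"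
      by (rule shift) measurable
    also have "\<dots> = (\<integral>\<^sup>+u. a (T y + u) * b u \<partial>lborel)"
      by (intro nn_integral_cong) (simp add: b_def indicator_def)
    finally show "(\<integral>\<^sup>+x. a x * b (T y - x) \<partial>lborel) = (\<integral>\<^sup>+u. a (T y + u) * b u \<partial>lborel)" .
  qed
  also have "\<dots> = (\<integral>\<^sup>+u. \<integral>\<^sup>+y. a (T y + u) * b u \<partial>lborel \<partial>lborel)"
    by (rule lborel_pair.Fubini') measurable
  also have "\<dots> = (\<integral>\<^sup>+u. emeasure (distr lborel borel T) A * b u \<partial>lborel)"
  proof (rule nn_integral_cong)
    fix u :: 'a
    have "(\<integral>\<^sup>+y. a (T y + u) \<partial>lborel) = (\<integral>\<^sup>+y. a (T y) \<partial>lborel)"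
      by (subst shift[where f = "\<lambda>y. a (T y)" and c = "?T' u"])
        (simp_all add: linear_add[OF lin] TT' add.commute)
    also have "\<dots> = (\<integral>\<^sup>+y. a y \<partial>distr lborel borel T)"
      by (simp add: nn_integral_distr)
    also have "\<dots> = emeasure (distr lborel borel T) A"
      by (simp add: a_def)
    finally show "(\<integral>\<^sup>+y. a (T y + u) * b u \<partial>lborel) = emeasure (distr lborel borel T) A * b u"
      by (simp add: nn_integral_multc)
  qed
  also have "\<dots> = emeasure (distr lborel borel T) A * \<beta>"
    by (simp add: nn_integral_cmult \<beta>_def)
  finally have eq: "emeasure lborel A * \<beta> = emeasure (distr lborel borel T) A * \<beta>" .
  have "\<beta> = emeasure lborel (ball (0::'a) 1)"
    by (simp add: \<beta>_def b_def)
  moreover have "emeasure lborel (ball (0::'a) 1) \<noteq> 0"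
    using content_ball_pos[of 1 "0::'a"] by (auto simp: measure_def)
  ultimately have "\<beta> \<noteq> 0" "\<beta> \<noteq> \<infinity>"
    using emeasure_lborel_ball_finite[of "0::'a" 1] by auto
  with eq show "emeasure (distr lborel borel T) A = emeasure lborel A"
    by (metis ennreal_mult_cancel_left infinity_ennreal_def mult.commute)
qed simp

text \<open>The tangent line of the convex function \<open>x powr p\<close> at \<open>a\<close>; integrating it gives the instance of Jensen's
  inequality needed below.\<close>
lemma powr_tangent_le:
  fixes a t p :: real
  assumes "p \<ge> 1" "a > 0" "t \<ge> 0"
  shows "a powr p + p * a powr (p - 1) * (t - a) \<le> t powr p"
proof (cases "t = 0")
  case True
  have "a powr (p - 1) * a = a powr p"
    using \<open>a > 0\<close> by (simp add: powr_diff)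
  then have "p * a powr (p - 1) * (t - a) = - (p * a powr p)"
    using True by (simp add: mult.assoc)
  also have "\<dots> \<le> - (a powr p)"
    using mult_right_mono[of 1 p "a powr p"] assms by simp
  finally show ?thesis using True by simp
next
  case False
  have "t powr p - a powr p \<ge> p * a powr (p - 1) * (t - a)"
  proof (rule convex_on_imp_above_tangent[OF powr_convex[OF \<open>p \<ge> 1\<close>]])
    show "((\<lambda>x. x powr p) has_real_derivative p * a powr (p - 1)) (at a within {0<..})"
      using \<open>a > 0\<close> by (auto intro!: derivative_eq_intros)
  qed (use assms False in \<open>auto simp: interior_open\<close>)
  then show ?thesis by simp
qed

text \<open>Cauchy's integral formula at the centre of the unit circle.\<close>
lemma holomorphic_circle_mean:
  assumes "\<phi> holomorphic_on S" "cball 0 1 \<subseteq> S"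
  shows "((\<lambda>t::real. \<phi> (exp (2 * of_real pi * \<i> * of_real t))) has_integral \<phi> 0) {0..1}"
proof -
  have "ball 0 1 \<subseteq> S"
    using ball_subset_cball assms(2) by (rule subset_trans)
  then have "((\<lambda>u. \<phi> u / (u - 0)) has_contour_integral 2 * of_real pi * \<i> * \<phi> 0) (circlepath 0 1)"
    using assms(2) by (intro Cauchy_integral_circlepath)
      (auto intro!: holomorphic_on_imp_continuous_on
          intro: holomorphic_on_subset[OF assms(1)])
  then have "((\<lambda>x. \<phi> (circlepath 0 1 x) / (circlepath 0 1 x) *
      vector_derivative (circlepath 0 1) (at x within {0..1})) has_integral 2 * of_real pi * \<i> * \<phi> 0) {0..1}"
    by (simp add: has_contour_integral_def)
  then have "((\<lambda>t::real. 2 * of_real pi * \<i> * \<phi> (exp (2 * of_real pi * \<i> * of_real t)))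
      has_integral 2 * of_real pi * \<i> * \<phi> 0) {0..1}"
    by (rule has_integral_eq[rotated]) (simp add: vector_derivative_circlepath01, simp add: circlepath)
  from has_integral_mult_right[OF this, of "1 / (2 * of_real pi * \<i>)"] show ?thesis
    by simp
qed

lemma holomorphic_circle_submean_powr:
  assumes hol: "\<phi> holomorphic_on S" "cball 0 1 \<subseteq> S" and p: "p \<ge> 1"
  shows "ennreal (norm (\<phi> 0) powr p) \<le>
    (\<integral>\<^sup>+t. ennreal (norm (\<phi> (exp (2 * of_real pi * \<i> * of_real t))) powr p) * indicator {0..1::real} t \<partial>lborel)"
proof (cases "\<phi> 0 = 0")
  case False
  let ?q = "\<lambda>t::real. norm (\<phi> (exp (2 * of_real pi * \<i> * of_real t)))"
  let ?a = "norm (\<phi> 0)"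
  have cont: "continuous_on {0..1} (\<lambda>t::real. \<phi> (exp (2 * of_real pi * \<i> * of_real t)))"
    by (rule continuous_on_compose2[OF holomorphic_on_imp_continuous_on[OF hol(1)]])
       (use hol(2) in \<open>auto intro!: continuous_intros\<close>)
  then have q_int: "?q integrable_on {0..1}"
    by (intro integrable_continuous_interval continuous_intros)
  have qp_int: "(\<lambda>t. ?q t powr p) integrable_on {0..1}"
    using cont p by (intro integrable_continuous_interval continuous_on_powr' continuous_intros) auto
  have mean: "((\<lambda>t::real. \<phi> (exp (2 * of_real pi * \<i> * of_real t))) has_integral \<phi> 0) {0..1}"
    by (rule holomorphic_circle_mean[OF hol])
  have "?a \<le> integral {0..1} ?q"
    using integral_norm_bound_integral[of "\<lambda>t::real. \<phi> (exp (2 * of_real pi * \<i> * of_real t))" "{0..1}" ?q]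
      mean q_int by (simp add: integral_unique has_integral_integrable)
  then have "?a powr p \<le> ?a powr p + p * ?a powr (p - 1) * (integral {0..1} ?q - ?a)"
    using p by simp
  also have "\<dots> \<le> integral {0..1} (\<lambda>t. ?q t powr p)"
  proof (rule has_integral_le)
    show "((\<lambda>t. ?a powr p + p * ?a powr (p - 1) * (?q t - ?a)) has_integral
        ?a powr p + p * ?a powr (p - 1) * (integral {0..1} ?q - ?a)) {0..1}"
      using has_integral_add[OF has_integral_const_real[of "?a powr p" 0 1]
          has_integral_mult_right[OF has_integral_diff[OF integrable_integral[OF q_int]
              has_integral_const_real[of ?a 0 1]], of "p * ?a powr (p - 1)"]]
      by simp
    show "?a powr p + p * ?a powr (p - 1) * (?q t - ?a) \<le> ?q t powr p" for t
      using False p by (intro powr_tangent_le) auto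
  qed (rule integrable_integral[OF qp_int])
  finally have "ennreal (?a powr p) \<le> ennreal (integral {0..1} (\<lambda>t. ?q t powr p))"
    by (rule ennreal_leI)
  also have "\<dots> = (\<integral>\<^sup>+t. ennreal (?q t powr p) * indicator {0..1} t \<partial>lborel)"
    using nn_integral_has_integral_lebesgue'[OF _ integrable_integral[OF qp_int]] by simp
  finally show ?thesis .
qed simp

lemma orthogonal_transformation_unit_scalar:
  assumes "norm c = 1"
  shows "orthogonal_transformation (\<lambda>v :: complex ^ 'n. c *s v)"
proof -
  have "linear (\<lambda>v :: complex ^ 'n. c *s v)"
    using bounded_linear_vector_scalar_mult_right by (rule bounded_linear.linear)
  then show ?thesis
    unfolding orthogonal_transformation using assms by (simp add: norm_vector_scalar_mult)
qed

text \<open>With \<open>u = w + v\<close>, multiplying \<open>v\<close> by a unit scalar does not change the integral over the ball. So one may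
  first average over all unit scalars; for fixed \<open>v\<close> in the ball this is a circle mean on the line through \<open>w\<close> in the direction \<open>v\<close>, which
  the one-variable inequality bounds below by \<open>\<bar>f w\<bar> powr p\<close>.\<close>
lemma submean_powr_ball:
  fixes f :: "complex ^ 'n \<Rightarrow> complex"
  assumes f: "holomorphic_Cn f (ball w r)" and p: "p \<ge> 1"
  shows "ennreal (norm (f w) powr p) * emeasure lborel (ball 0 r :: (complex ^ 'n) set) \<le>
    (\<integral>\<^sup>+u. ennreal (norm (f u) powr p) * indicator (ball w r) u \<partial>lborel)"
proof -
  define h where "h = (\<lambda>u. ennreal (norm (f u) powr p) * indicator (ball w r) u)"
  define E where "E = (\<lambda>t::real. exp (2 * of_real pi * \<i> * of_real t))"
  have nE: "norm (E t) = 1" for t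
    by (simp add: E_def)
  have "(\<lambda>u. indicator (ball w r) u *\<^sub>R (norm (f u) powr p)) \<in> borel_measurable borel"
    using holomorphic_Cn_continuous_on[OF f] p
    by (intro borel_measurable_continuous_on_indicator continuous_on_powr' continuous_intros) auto
  then have "(\<lambda>u. ennreal (indicator (ball w r) u *\<^sub>R (norm (f u) powr p))) \<in> borel_measurable borel"
    by (rule measurable_compose[OF _ measurable_ennreal])
  also have "(\<lambda>u. ennreal (indicator (ball w r) u *\<^sub>R (norm (f u) powr p))) = h"
    by (auto simp: h_def indicator_def)
  finally have [measurable]: "h \<in> borel_measurable borel" .
  have shift: "(\<integral>\<^sup>+u. h u \<partial>lborel) = (\<integral>\<^sup>+v. h (w + c *s v) \<partial>lborel)" if c: "norm c = 1" for c
  proof -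
    have [measurable]: "(\<lambda>v :: complex ^ 'n. c *s v) \<in> borel_measurable borel"
      by (intro borel_measurable_continuous_onI linear_continuous_on
          bounded_linear_vector_scalar_mult_right)
    have "(\<integral>\<^sup>+u. h u \<partial>lborel) = (\<integral>\<^sup>+u. h (w + u) \<partial>lborel)"
      by (subst lborel_distr_plus[of w, symmetric], subst nn_integral_distr) auto
    also have "\<dots> = (\<integral>\<^sup>+v. h (w + c *s v) \<partial>lborel)"
      by (subst distr_lborel_orthogonal_transformation
          [OF orthogonal_transformation_unit_scalar[OF c], symmetric], subst nn_integral_distr) auto
    finally show ?thesis .
  qed
  have [measurable]: "(\<lambda>(v, t). h (w + E t *s v)) \<in> borel_measurable (lborel \<Otimes>\<^sub>M lborel)"
  proof -
    have "continuous_on UNIV (\<lambda>x. w + E (snd x) *s (fst x :: complex ^ 'n))"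
      unfolding E_def vector_scalar_mult_def by (intro continuous_intros)
    then have "(\<lambda>x. w + E (snd x) *s (fst x :: complex ^ 'n)) \<in> borel_measurable borel"
      by (rule borel_measurable_continuous_onI)
    then have "(\<lambda>x. h (w + E (snd x) *s fst x)) \<in> borel_measurable borel"
      by measurable
    then show ?thesis by (simp add: lborel_prod case_prod_beta)
  qed
  have "ennreal (norm (f w) powr p) * emeasure lborel (ball 0 r :: (complex ^ 'n) set) = (\<integral>\<^sup>+v. ennreal (norm (f w) powr p) * indicator (ball 0 r) v \<partial>(lborel :: (complex ^ 'n) measure))"
    by (subst nn_integral_cmult_indicator) auto
  also have "\<dots> \<le> (\<integral>\<^sup>+v. \<integral>\<^sup>+t. h (w + E t *s v) * indicator {0..1} t \<partial>lborel \<partial>lborel)"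
  proof (rule nn_integral_mono)
    fix v :: "complex ^ 'n"
    show "ennreal (norm (f w) powr p) * indicator (ball 0 r) v \<le>
        (\<integral>\<^sup>+t. h (w + E t *s v) * indicator {0..1} t \<partial>lborel)"
    proof (cases "v \<in> ball 0 r")
      case True
      let ?S = "{\<zeta>. norm (\<zeta> *s v) < r}"
      have "cball 0 1 \<subseteq> ?S"
        using True by (auto simp: norm_vector_scalar_mult intro: le_less_trans[OF mult_right_mono[of _ 1]])
      moreover have "(\<lambda>\<zeta>. f (w + \<zeta> *s v)) holomorphic_on ?S"
        by (rule holomorphic_on_line[OF f]) (auto simp: dist_norm)
      ultimately have "ennreal (norm (f (w + 0 *s v)) powr p) \<le>
          (\<integral>\<^sup>+t. ennreal (norm (f (w + E t *s v)) powr p) * indicator {0..1} t \<partial>lborel)"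
        unfolding E_def using holomorphic_circle_submean_powr[of "\<lambda>\<zeta>. f (w + \<zeta> *s v)"] p by blast
      moreover have "h (w + E t *s v) = ennreal (norm (f (w + E t *s v)) powr p)" for t
        using True by (simp add: h_def dist_norm norm_vector_scalar_mult nE)
      ultimately show ?thesis using True by simp
    qed simp
  qed
  also have "\<dots> = (\<integral>\<^sup>+t. \<integral>\<^sup>+v. h (w + E t *s v) * indicator {0..1} t \<partial>lborel \<partial>lborel)"
    by (rule lborel_pair.Fubini') measurable
  also have "\<dots> = (\<integral>\<^sup>+t. (\<integral>\<^sup>+u. h u \<partial>lborel) * indicator {0..1::real} t \<partial>lborel)"
  proof (rule nn_integral_cong)
    fix t :: real
    have [measurable]: "(\<lambda>v. h (w + E t *s v)) \<in> borel_measurable lborel"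
      by measurable
    show "(\<integral>\<^sup>+v. h (w + E t *s v) * indicator {0..1} t \<partial>lborel) = (\<integral>\<^sup>+u. h u \<partial>lborel) * indicator {0..1::real} t"
      by (simp add: nn_integral_multc shift[OF nE[of t], symmetric])
  qed
  also have "\<dots> = (\<integral>\<^sup>+u. h u \<partial>lborel)"
    by (simp add: nn_integral_cmult)
  finally show ?thesis by (simp add: h_def)
qed

section \<open>Normal families\<close>
lemma holomorphic_Cn_Lipschitz:
  assumes f: "holomorphic_Cn f (ball w (2 * r))" and r: "r > 0"
    and M: "\<And>y. y \<in> ball w (2 * r) \<Longrightarrow> norm (f y) \<le> M"
    and xy: "x \<in> ball w r" "y \<in> ball w r"
  shows "norm (f x - f y) \<le> M / r * norm (x - y)"
proof (rule differentiable_bound[where f' = "\<lambda>x. frechet_derivative f (at x)" and S = "ball w r"])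
  fix u assume u: "u \<in> ball w r"
  have sub: "ball u r \<subseteq> ball w (2 * r)"
    using u by (simp add: ball_subset_ball_iff dist_commute)
  show "(f has_derivative frechet_derivative f (at u)) (at u within ball w r)"
    by (rule has_derivative_at_withinI, rule holomorphic_CnD(1)[OF f]) (use u r in auto)
  show "onorm (frechet_derivative f (at u)) \<le> M / r"
  proof (rule onorm_le)
    show "norm (frechet_derivative f (at u) v) \<le> M / r * norm v" for v
      using Cauchy_estimate_frechet[OF holomorphic_Cn_subset[OF f sub] r] M sub by blast
  qed
qed (use xy in auto)

text \<open>The common Lipschitz constant transfers the Cauchy property from finitely many points of the dense
  set, whose small neighbourhoods cover the compact ball, to the whole ball.\<close>
lemma uniformly_Cauchy_if_dense_convergent:
  fixes f :: "nat \<Rightarrow> complex ^ 'n \<Rightarrow> complex"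
  assumes f: "\<And>k. holomorphic_Cn (f k) (ball w (2 * r))" and r: "r > 0"
    and M: "\<And>k y. y \<in> ball w (2 * r) \<Longrightarrow> norm (f k y) \<le> M"
    and dense: "ball w r \<subseteq> closure (D \<inter> ball w r)"
    and conv: "\<And>d. d \<in> D \<inter> ball w r \<Longrightarrow> convergent (\<lambda>k. f k d)"
    and "e > 0"
  shows "\<exists>N. \<forall>m\<ge>N. \<forall>n\<ge>N. \<forall>x\<in>ball w r. norm (f m x - f n x) < e"
proof -
  define L where "L = M / r + 1"
  have "M \<ge> 0"
    using order_trans[OF norm_ge_zero M[of w 0]] r by simp
  then have L: "L > 0" "M / r \<le> L" using r by (auto simp: L_def add_nonneg_pos)
  have lip: "norm (f k x - f k y) \<le> L * norm (x - y)" if "x \<in> ball w r" "y \<in> ball w r" for k x y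
    using order_trans[OF holomorphic_Cn_Lipschitz[OF f r M that] mult_right_mono[OF L(2)]] by simp
  define \<delta> where "\<delta> = e / (3 * L)"
  have \<delta>: "\<delta> > 0" "L * \<delta> = e / 3" using L \<open>e > 0\<close> by (auto simp: \<delta>_def)
  have "cball w r \<subseteq> closure (ball w r)"
    using r by simp
  also have "\<dots> \<subseteq> closure (D \<inter> ball w r)"
    using dense by (simp add: closure_minimal)
  also have "\<dots> \<subseteq> (\<Union>d\<in>D \<inter> ball w r. ball d \<delta>)"
    using \<delta>(1) by (fastforce simp: closure_approachable)
  finally obtain T where T: "T \<subseteq> D \<inter> ball w r" "finite T" "cball w r \<subseteq> (\<Union>d\<in>T. ball d \<delta>)"
    by (auto intro: compactE_image[OF compact_cball, of "D \<inter> ball w r" "\<lambda>d. ball d \<delta>"])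
  have "\<forall>d\<in>T. \<exists>N. \<forall>m\<ge>N. \<forall>n\<ge>N. norm (f m d - f n d) < e / 3"
  proof
    fix d assume "d \<in> T"
    then have "Cauchy (\<lambda>k. f k d)" using conv T(1) convergent_Cauchy by blast
    then show "\<exists>N. \<forall>m\<ge>N. \<forall>n\<ge>N. norm (f m d - f n d) < e / 3"
      by (rule CauchyD) (use \<open>e > 0\<close> in simp)
  qed
  then obtain N where N: "\<And>d m n. d \<in> T \<Longrightarrow> m \<ge> N d \<Longrightarrow> n \<ge> N d \<Longrightarrow> norm (f m d - f n d) < e / 3"
    by metis
  have "norm (f m x - f n x) < e" if m: "m \<ge> Max (N ` T)" and n: "n \<ge> Max (N ` T)" and x: "x \<in> ball w r" for m n x
  proof -
    obtain d where d: "d \<in> T" "x \<in> ball d \<delta>"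
      using subsetD[OF T(3) subsetD[OF ball_subset_cball x]] by blast
    then have "d \<in> ball w r" using T(1) by blast
    have close: "norm (f k x - f k d) \<le> e / 3" for k
    proof -
      have "norm (f k x - f k d) \<le> L * norm (x - d)" by (rule lip[OF x \<open>d \<in> ball w r\<close>])
      also have "\<dots> \<le> L * \<delta>"
        using d(2) L(1) by (intro mult_left_mono) (auto simp: dist_norm norm_minus_commute)
      finally show ?thesis by (simp add: \<delta>(2))
    qed
    have "N d \<le> Max (N ` T)" using d(1) T(2) by simp
    then have "norm (f m d - f n d) < e / 3" using m n d(1) by (intro N) auto
    moreover have "norm (f m x - f n x) \<le> norm (f m x - f m d) + norm (f m d - f n d) + norm (f n x - f n d)"
      using norm_triangle_ineq4[of "(f m x - f m d) + (f m d - f n d)" "f n x - f n d"]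
        norm_triangle_ineq[of "f m x - f m d" "f m d - f n d"] by simp
    ultimately show ?thesis using close[of m] close[of n] by linarith
  qed
  then show ?thesis by (intro exI[of _ "Max (N ` T)"] allI impI ballI)
qed

text \<open>Cauchy's estimate applied to the differences \<open>f m - f n\<close> makes the derivatives uniformly Cauchy on the
  smaller ball, so that limit and derivative may be interchanged; complex linearity survives the
  pointwise limit.\<close>
lemma Weierstrass_convergence_ball:
  fixes f :: "nat \<Rightarrow> complex ^ 'n \<Rightarrow> complex"
  assumes f: "\<And>k. holomorphic_Cn (f k) (ball w (2 * r))" and r: "r > 0"
    and Cauchy: "\<And>e. e > 0 \<Longrightarrow>
      \<exists>N. \<forall>m\<ge>N. \<forall>n\<ge>N. \<forall>x\<in>ball w (2 * r). norm (f m x - f n x) < e"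
  obtains g where "\<And>x. x \<in> ball w r \<Longrightarrow> (\<lambda>k. f k x) \<longlonglongrightarrow> g x"
    and "holomorphic_Cn g (ball w r)"
    and "\<And>x v. x \<in> ball w r \<Longrightarrow>
      (\<lambda>k. frechet_derivative (f k) (at x) v) \<longlonglongrightarrow> frechet_derivative g (at x) v"
proof -
  define F where "F = (\<lambda>k x. frechet_derivative (f k) (at x))"
  define G where "G = (\<lambda>x v. lim (\<lambda>k. F k x v))"
  have sub: "ball x r \<subseteq> ball w (2 * r)" if "x \<in> ball w r" for x
    using that by (simp add: ball_subset_ball_iff dist_commute)
  have in2: "x \<in> ball w (2 * r)" if "x \<in> ball w r" for x
    using that r by auto
  have der: "(f k has_derivative F k x) (at x)" "F k x (c *s v) = c * F k x v"
    if "x \<in> ball w r" for k x c v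
    unfolding F_def using holomorphic_CnD[OF f in2[OF that]] by blast+
  have FC: "\<exists>N. \<forall>m\<ge>N. \<forall>n\<ge>N. \<forall>x\<in>ball w r. \<forall>v. norm (F m x v - F n x v) \<le> e * norm v" if "e > 0" for e
  proof -
    obtain N where N: "\<And>m n x. m \<ge> N \<Longrightarrow> n \<ge> N \<Longrightarrow> x \<in> ball w (2 * r) \<Longrightarrow> norm (f m x - f n x) < e * r"
      using Cauchy[of "e * r"] \<open>e > 0\<close> r by (meson mult_pos_pos)
    have "norm (F m x v - F n x v) \<le> e * norm v" if "m \<ge> N" "n \<ge> N" and x: "x \<in> ball w r" for m n x v
    proof -
      have diff: "((\<lambda>y. f m y - f n y) has_derivative
           (\<lambda>v. frechet_derivative (f m) (at y) v - frechet_derivative (f n) (at y) v)) (at y)"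
        if "y \<in> ball w (2 * r)" for y
        using holomorphic_CnD(1)[OF f that] by (intro has_derivative_diff)
      have "holomorphic_Cn (\<lambda>y. f m y - f n y) (ball x r)"
        unfolding holomorphic_Cn_def
      proof (intro ballI exI conjI allI)
        fix y assume "y \<in> ball x r"
        then have y: "y \<in> ball w (2 * r)" using sub[OF x] by blast
        show "((\<lambda>y. f m y - f n y) has_derivative
           (\<lambda>v. frechet_derivative (f m) (at y) v - frechet_derivative (f n) (at y) v)) (at y)"
          by (rule diff[OF y])
        show "frechet_derivative (f m) (at y) (c *s v) - frechet_derivative (f n) (at y) (c *s v) =
          c * (frechet_derivative (f m) (at y) v - frechet_derivative (f n) (at y) v)" for c v
          by (simp add: holomorphic_CnD(2)[OF f y] algebra_simps)
      qed
      moreover have "norm (f m y - f n y) \<le> e * r" if "y \<in> ball x r" for y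
        using N[OF \<open>m \<ge> N\<close> \<open>n \<ge> N\<close>] sub[OF x] that by (meson less_imp_le subsetD)
      ultimately have "norm (frechet_derivative (\<lambda>y. f m y - f n y) (at x) v) \<le> (e * r) / r * norm v"
        by (rule Cauchy_estimate_frechet[OF _ r])
      also have "frechet_derivative (\<lambda>y. f m y - f n y) (at x) v = F m x v - F n x v"
        using fun_cong[OF frechet_derivative_at[OF diff[OF in2[OF x]], symmetric], of v] by (simp add: F_def)
      finally show ?thesis using r by simp
    qed
    then show ?thesis by blast
  qed
  have lim: "(\<lambda>k. F k x v) \<longlonglongrightarrow> G x v" if x: "x \<in> ball w r" for x v
  proof -
    have "Cauchy (\<lambda>k. F k x v)"
    proof (rule CauchyI)
      fix e :: real assume "e > 0"
      then have "e / (norm v + 1) > 0" by (simp add: add_nonneg_pos)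
      from FC[OF this] obtain N where N: "\<And>m n. m \<ge> N \<Longrightarrow> n \<ge> N \<Longrightarrow>
          norm (F m x v - F n x v) \<le> e / (norm v + 1) * norm v"
        using x by blast
      have pos: "norm v + 1 > 0" by (simp add: add_nonneg_pos)
      have "e * norm v < e * (norm v + 1)"
        using \<open>e > 0\<close> by simp
      then have "e / (norm v + 1) * norm v < e"
        unfolding times_divide_eq_left pos_divide_less_eq[OF pos] .
      with N show "\<exists>N. \<forall>m\<ge>N. \<forall>n\<ge>N. norm (F m x v - F n x v) < e"
        by (meson le_less_trans)
    qed
    then show ?thesis
      by (simp add: G_def convergent_LIMSEQ_iff[symmetric] Cauchy_convergent)
  qed
  have unif: "\<forall>\<^sub>F n in sequentially. \<forall>x\<in>ball w r. \<forall>h. norm (F n x h - G x h) \<le> e * norm h"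
    if "e > 0" for e
  proof -
    obtain N where N: "\<And>m n x v. m \<ge> N \<Longrightarrow> n \<ge> N \<Longrightarrow> x \<in> ball w r \<Longrightarrow> norm (F m x v - F n x v) \<le> e * norm v"
      using FC[OF \<open>e > 0\<close>] by meson
    have "norm (F n x h - G x h) \<le> e * norm h" if "n \<ge> N" "x \<in> ball w r" for n x h
    proof (rule tendsto_upperbound)
      show "(\<lambda>m. norm (F n x h - F m x h)) \<longlonglongrightarrow> norm (F n x h - G x h)"
        by (intro tendsto_intros lim that)
      show "\<forall>\<^sub>F m in sequentially. norm (F n x h - F m x h) \<le> e * norm h"
        using N that by (intro eventually_sequentiallyI[of N]) auto
    qed simp
    then show ?thesis
      by (intro eventually_sequentiallyI[of N]) auto
  qed
  have "convergent (\<lambda>k. f k w)"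
  proof (rule Cauchy_convergent, rule CauchyI)
    fix e :: real assume "e > 0"
    then show "\<exists>N. \<forall>m\<ge>N. \<forall>n\<ge>N. norm (f m w - f n w) < e"
      using Cauchy[of e] r by (metis centre_in_ball mult_pos_pos zero_less_numeral)
  qed
  then obtain l where l: "(\<lambda>k. f k w) \<longlonglongrightarrow> l" by (auto simp: convergent_def)
  have "\<exists>g. \<forall>x\<in>ball w r. (\<lambda>k. f k x) \<longlonglongrightarrow> g x \<and> (g has_derivative G x) (at x within ball w r)"
  proof (rule has_derivative_sequence[OF convex_ball _ unif])
    show "(f n has_derivative F n x) (at x within ball w r)" if "x \<in> ball w r" for n x
      using der(1)[OF that] by (rule has_derivative_at_withinI)
  qed (use r l in auto)
  then obtain g where g: "\<And>x. x \<in> ball w r \<Longrightarrow> (\<lambda>k. f k x) \<longlonglongrightarrow> g x"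
      "\<And>x. x \<in> ball w r \<Longrightarrow> (g has_derivative G x) (at x)"
    by (metis at_within_open open_ball)
  have Gc: "G x (c *s v) = c * G x v" if "x \<in> ball w r" for x c v
    by (rule LIMSEQ_unique[OF lim[OF that]]) (simp add: der(2)[OF that] tendsto_mult_left lim[OF that])
  show ?thesis
  proof (rule that[of g])
    show "holomorphic_Cn g (ball w r)"
      unfolding holomorphic_Cn_def using g(2) Gc by blast
    show "(\<lambda>k. frechet_derivative (f k) (at x) v) \<longlonglongrightarrow> frechet_derivative g (at x) v"
      if "x \<in> ball w r" for x v
      using lim[OF that] frechet_derivative_at[OF g(2)[OF that]] by (simp add: F_def)
  qed (rule g(1))
qed

text \<open>A diagonal subsequence converges on a countable dense subset. By the two preceding lemmas it then
  converges, with its derivatives, near every point; the local limits agree because they are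
  pointwise limits.\<close>
theorem Montel_Cn:
  fixes f :: "nat \<Rightarrow> complex ^ 'n \<Rightarrow> complex"
  assumes f: "\<And>k. holomorphic_Cn (f k) S"
    and loc: "\<And>w. w \<in> S \<Longrightarrow> \<exists>r>0. \<exists>M. ball w r \<subseteq> S \<and> (\<forall>k. \<forall>y\<in>ball w r. norm (f k y) \<le> M)"
  obtains g s where "strict_mono (s :: nat \<Rightarrow> nat)" "holomorphic_Cn g S"
    and "\<And>x. x \<in> S \<Longrightarrow> (\<lambda>k. f (s k) x) \<longlonglongrightarrow> g x"
    and "\<And>x v. x \<in> S \<Longrightarrow>
      (\<lambda>k. frechet_derivative (f (s k)) (at x) v) \<longlonglongrightarrow> frechet_derivative g (at x) v"
proof -
  obtain D where D: "countable D" "D \<subseteq> S" "S \<subseteq> closure D"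
    using separable by blast
  have "\<forall>w\<in>S. \<exists>M>0. \<forall>k. norm (f k w) \<le> M"
  proof
    fix w assume "w \<in> S"
    from loc[OF this] obtain r M where "r > 0" "\<And>k y. y \<in> ball w r \<Longrightarrow> norm (f k y) \<le> M" by blast
    then have "\<And>k. norm (f k w) \<le> max M 1" by (meson centre_in_ball max.coboundedI1)
    then show "\<exists>M>0. \<forall>k. norm (f k w) \<le> M" by (intro exI[of _ "max M 1"]) auto
  qed
  then obtain B where B: "\<And>w. w \<in> S \<Longrightarrow> B w > 0" "\<And>w k. w \<in> S \<Longrightarrow> norm (f k w) \<le> B w"
    by metis
  \<comment> \<open>The diagonal argument asks for one bound valid at all points of \<open>D\<close>, whereas \<open>B\<close> varies with the
     point, so it is applied to the quotients by \<open>B\<close>.\<close>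
  have normalized: "norm (f k d / of_real (B d)) \<le> 1" if "d \<in> D" for k d
    using B[of d] D(2) that by (auto simp: norm_divide divide_le_eq)
  have "\<exists>s. strict_mono (s :: nat \<Rightarrow> nat) \<and> (\<forall>d\<in>D. \<exists>l. (\<lambda>k. f (s k) d / of_real (B d)) \<longlonglongrightarrow> l)"
  proof (rule function_convergent_subsequence[OF D(1) normalized])
    fix s :: "nat \<Rightarrow> nat"
    assume "strict_mono s" "\<And>d. d \<in> D \<Longrightarrow> \<exists>l. (\<lambda>k. f (s k) d / of_real (B d)) \<longlonglongrightarrow> l"
    then show ?thesis by blast
  qed
  then obtain s where s: "strict_mono (s :: nat \<Rightarrow> nat)"
    "\<And>d. d \<in> D \<Longrightarrow> \<exists>l. (\<lambda>k. f (s k) d / of_real (B d)) \<longlonglongrightarrow> l"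
    by blast
  have conv: "convergent (\<lambda>k. f (s k) d)" if d: "d \<in> D" for d
  proof -
    obtain l where "(\<lambda>k. f (s k) d / of_real (B d)) \<longlonglongrightarrow> l" using s(2)[OF d] by blast
    then have "(\<lambda>k. f (s k) d / of_real (B d) * of_real (B d)) \<longlonglongrightarrow> l * of_real (B d)"
      by (rule tendsto_mult_right)
    moreover have "B d > 0" using B(1) d D(2) by blast
    ultimately show ?thesis by (auto simp: convergent_def)
  qed
  have local: "\<exists>r>0. \<exists>g. ball w r \<subseteq> S \<and> (\<forall>x\<in>ball w r. (\<lambda>k. f (s k) x) \<longlonglongrightarrow> g x) \<and>
      holomorphic_Cn g (ball w r) \<and>
      (\<forall>x\<in>ball w r. \<forall>v. (\<lambda>k. frechet_derivative (f (s k)) (at x) v) \<longlonglongrightarrow> frechet_derivative g (at x) v)"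
    if w: "w \<in> S" for w
  proof -
    obtain R M where R: "R > 0" "ball w R \<subseteq> S" "\<And>k y. y \<in> ball w R \<Longrightarrow> norm (f k y) \<le> M"
      using loc[OF w] by blast
    define r where "r = R / 4"
    have r: "r > 0" "ball w (2 * (2 * r)) = ball w R" using R(1) by (auto simp: r_def)
    have sub: "ball w (2 * r) \<subseteq> S" "ball w r \<subseteq> S" using r R(1,2) by (auto simp: r_def)
    have dense: "ball w (2 * r) \<subseteq> closure (D \<inter> ball w (2 * r))"
    proof -
      have "ball w (2 * r) \<subseteq> ball w (2 * r) \<inter> closure D" using sub(1) D(3) by blast
      also have "\<dots> \<subseteq> closure (ball w (2 * r) \<inter> D)" by (rule open_Int_closure_subset) simp
      finally show ?thesis by (simp add: Int_commute)
    qed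
    have C: "\<exists>N. \<forall>m\<ge>N. \<forall>n\<ge>N. \<forall>x\<in>ball w (2 * r). norm (f (s m) x - f (s n) x) < e" if "e > 0" for e
      by (rule uniformly_Cauchy_if_dense_convergent[where M = M and D = D])
         (use r(1) R(3) holomorphic_Cn_subset[OF f R(2)] dense conv that in \<open>auto simp only: r(2) mult_pos_pos zero_less_numeral\<close>)
    show ?thesis
    proof (rule Weierstrass_convergence_ball[OF holomorphic_Cn_subset[OF f sub(1)] r(1) C])
      fix g assume "\<And>x. x \<in> ball w r \<Longrightarrow> (\<lambda>k. f (s k) x) \<longlonglongrightarrow> g x"
        and "holomorphic_Cn g (ball w r)"
        and "\<And>x v. x \<in> ball w r \<Longrightarrow>
          (\<lambda>k. frechet_derivative (f (s k)) (at x) v) \<longlonglongrightarrow> frechet_derivative g (at x) v"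
      then show ?thesis using r(1) sub(2) by blast
    qed
  qed
  define g where "g = (\<lambda>x. lim (\<lambda>k. f (s k) x))"
  have gD: "(\<lambda>k. f (s k) x) \<longlonglongrightarrow> g x \<and>
      (\<exists>g'. (g has_derivative g') (at x) \<and> (\<forall>c v. g' (c *s v) = c * g' v)) \<and>
      (\<forall>v. (\<lambda>k. frechet_derivative (f (s k)) (at x) v) \<longlonglongrightarrow> frechet_derivative g (at x) v)"
    if x: "x \<in> S" for x
  proof -
    obtain r h where h: "r > 0" "\<And>y. y \<in> ball x r \<Longrightarrow> (\<lambda>k. f (s k) y) \<longlonglongrightarrow> h y"
      "holomorphic_Cn h (ball x r)"
      "\<And>v. (\<lambda>k. frechet_derivative (f (s k)) (at x) v) \<longlonglongrightarrow> frechet_derivative h (at x) v"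
      using local[OF x] by (metis centre_in_ball)
    have gh: "g y = h y" if "y \<in> ball x r" for y
      using h(2)[OF that] by (simp add: g_def limI)
    have xin: "x \<in> ball x r" using h(1) by simp
    have D: "(g has_derivative frechet_derivative h (at x)) (at x)"
      by (rule has_derivative_transform_within_open[OF holomorphic_CnD(1)[OF h(3) xin] open_ball xin])
         (simp add: gh)
    show ?thesis
    proof (intro conjI exI allI)
      show "(\<lambda>k. f (s k) x) \<longlonglongrightarrow> g x"
        using h(2)[OF xin] gh[OF xin] by simp
      show "(g has_derivative frechet_derivative h (at x)) (at x)" by (rule D)
      show "frechet_derivative h (at x) (c *s v) = c * frechet_derivative h (at x) v" for c v
        by (rule holomorphic_CnD(2)[OF h(3) xin])
      show "(\<lambda>k. frechet_derivative (f (s k)) (at x) v) \<longlonglongrightarrow> frechet_derivative g (at x) v" for v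
        unfolding frechet_derivative_at[OF D, symmetric] by (rule h(4))
    qed
  qed
  show ?thesis
  proof (rule that[OF s(1), of g])
    show "holomorphic_Cn g S"
      unfolding holomorphic_Cn_def by (intro ballI conjunct1[OF conjunct2[OF gD]])
    show "(\<lambda>k. f (s k) x) \<longlonglongrightarrow> g x" if "x \<in> S" for x
      using gD[OF that] by (rule conjunct1)
    show "(\<lambda>k. frechet_derivative (f (s k)) (at x) v) \<longlonglongrightarrow> frechet_derivative g (at x) v"
      if "x \<in> S" for x v
      using gD[OF that] by (elim conjE allE)
  qed
qed

section \<open>Comparing Bergman norms and sup norms\<close>

text \<open>This is the \<open>p\<close>-th root of the sub-mean value inequality.\<close>
lemma pointwise_bound_bergman:
  fixes f :: "complex ^ 'n \<Rightarrow> complex"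
  assumes f: "f \<in> bergman_space p \<Omega>" and p: "p \<ge> 1" and r: "r > 0" "ball w r \<subseteq> \<Omega>"
  shows "norm (f w) \<le> measure lborel (ball 0 r :: (complex ^ 'n) set) powr (- 1 / p) * Lp_norm p \<Omega> f"
proof -
  let ?\<mu> = "measure lborel (ball 0 r :: (complex ^ 'n) set)"
  let ?I = "set_lebesgue_integral lebesgue \<Omega> (\<lambda>z. norm (f z) powr p)"
  have \<mu>: "?\<mu> > 0" using content_ball_pos[OF r(1)] .
  have \<mu>_em: "emeasure lborel (ball 0 r :: (complex ^ 'n) set) = ennreal ?\<mu>"
    using emeasure_lborel_ball_finite[of "0 :: complex ^ 'n" r] by (simp add: emeasure_eq_ennreal_measure)
  have hol: "holomorphic_Cn f (ball w r)" and int: "set_integrable lebesgue \<Omega> (\<lambda>z. norm (f z) powr p)"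
    using f r(2) by (auto simp: bergman_space_def intro: holomorphic_Cn_subset)
  have "ennreal (norm (f w) powr p * ?\<mu>) =
      ennreal (norm (f w) powr p) * emeasure lborel (ball 0 r :: (complex ^ 'n) set)"
    by (simp add: \<mu>_em ennreal_mult'')
  also have "\<dots> \<le> (\<integral>\<^sup>+u. ennreal (norm (f u) powr p) * indicator (ball w r) u \<partial>lborel)"
    by (rule submean_powr_ball[OF hol p])
  also have "\<dots> = (\<integral>\<^sup>+u. ennreal (norm (f u) powr p) * indicator (ball w r) u \<partial>lebesgue)"
    by (simp add: nn_integral_completion)
  also have "\<dots> \<le> (\<integral>\<^sup>+u. ennreal (indicator \<Omega> u *\<^sub>R (norm (f u) powr p)) \<partial>lebesgue)"
    using r(2) by (intro nn_integral_mono) (auto simp: indicator_def)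
  also have "\<dots> = ennreal ?I"
    using int unfolding set_integrable_def set_lebesgue_integral_def
    by (intro nn_integral_eq_integral) auto
  finally have "norm (f w) powr p * ?\<mu> \<le> ?I"
    by (subst (asm) ennreal_le_iff) (auto simp: set_lebesgue_integral_def)
  then have "(norm (f w) powr p * ?\<mu>) powr (1 / p) \<le> ?I powr (1 / p)"
    using p \<mu> by (intro powr_mono2) auto
  then have "norm (f w) * ?\<mu> powr (1 / p) \<le> Lp_norm p \<Omega> f"
    using p \<mu> by (simp add: Lp_norm_def powr_mult powr_powr)
  then have "?\<mu> powr (- 1 / p) * (norm (f w) * ?\<mu> powr (1 / p)) \<le> ?\<mu> powr (- 1 / p) * Lp_norm p \<Omega> f"
    by (intro mult_left_mono) auto
  also have "?\<mu> powr (- 1 / p) * (norm (f w) * ?\<mu> powr (1 / p)) = norm (f w)"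
    using \<mu> by (simp add: powr_minus field_simps)
  finally show ?thesis .
qed

lemma Lp_norm_nonneg: "Lp_norm p \<Omega> f \<ge> 0"
  by (simp add: Lp_norm_def)

lemma holomorphic_Cn_cmult:
  assumes f: "holomorphic_Cn f S"
  shows "holomorphic_Cn (\<lambda>w. a * f w) S"
    and "z \<in> S \<Longrightarrow> vector_deriv X (\<lambda>w. a * f w) z = a * vector_deriv X f z"
proof -
  have D: "((\<lambda>w. a * f w) has_derivative (\<lambda>v. a * frechet_derivative f (at x) v)) (at x)"
    if "x \<in> S" for x
    using holomorphic_CnD(1)[OF f that] by (rule has_derivative_mult_right)
  show hol: "holomorphic_Cn (\<lambda>w. a * f w) S"
    unfolding holomorphic_Cn_def
  proof (intro ballI exI conjI allI)
    fix x assume x: "x \<in> S"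
    show "((\<lambda>w. a * f w) has_derivative (\<lambda>v. a * frechet_derivative f (at x) v)) (at x)"
      by (rule D[OF x])
    show "a * frechet_derivative f (at x) (c *s v) = c * (a * frechet_derivative f (at x) v)" for c v
      by (simp add: holomorphic_CnD(2)[OF f x])
  qed
  show "vector_deriv X (\<lambda>w. a * f w) z = a * vector_deriv X f z" if "z \<in> S"
    using vector_deriv_eq_frechet_derivative[OF hol that] vector_deriv_eq_frechet_derivative[OF f that]
      fun_cong[OF frechet_derivative_at[OF D[OF that]], of X] by simp
qed

lemma bergman_space_cmult:
  assumes f: "f \<in> bergman_space p \<Omega>" and p: "p > 0"
  shows "(\<lambda>w. a * f w) \<in> bergman_space p \<Omega>"
    and "Lp_norm p \<Omega> (\<lambda>w. a * f w) = norm a * Lp_norm p \<Omega> f"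
proof -
  have eq: "norm (a * f w) powr p = norm a powr p * norm (f w) powr p" for w
    by (simp add: norm_mult powr_mult)
  show "(\<lambda>w. a * f w) \<in> bergman_space p \<Omega>"
    using f holomorphic_Cn_cmult(1)[of f \<Omega> a]
    unfolding bergman_space_def mem_Collect_eq eq by (auto intro: set_integrable_mult_right)
  show "Lp_norm p \<Omega> (\<lambda>w. a * f w) = norm a * Lp_norm p \<Omega> f"
    using p unfolding Lp_norm_def eq
    by (simp add: set_lebesgue_integral_def powr_mult powr_powr mult.left_commute)
qed

lemma bounded_holomorphic_in_bergman_space:
  fixes \<Omega> :: "(complex ^ 'n) set"
  assumes \<Omega>: "open \<Omega>" "bounded \<Omega>" and f: "holomorphic_Cn f \<Omega>" and p: "p > 0"
    and B: "\<And>w. w \<in> \<Omega> \<Longrightarrow> norm (f w) \<le> B" "B \<ge> 0"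
  shows "f \<in> bergman_space p \<Omega>" and "Lp_norm p \<Omega> f \<le> B * measure lebesgue \<Omega> powr (1 / p)"
proof -
  have lm: "\<Omega> \<in> lmeasurable"
    using \<Omega> by (intro bounded_set_imp_lmeasurable) auto
  have le: "norm (indicator \<Omega> x *\<^sub>R norm (f x) powr p) \<le> norm (B powr p * indicator \<Omega> x)" for x
    using B p by (auto simp: indicator_def intro: powr_mono2)
  have intB: "integrable lebesgue (\<lambda>x. B powr p * indicator \<Omega> x)"
    using lm by (intro integrable_mult_right integrable_real_indicator) (auto simp: fmeasurable_def)
  have "(\<lambda>x. indicator \<Omega> x *\<^sub>R norm (f x) powr p) \<in> borel_measurable borel"
    using \<Omega>(1) holomorphic_Cn_continuous_on[OF f] p
    by (intro borel_measurable_continuous_on_indicator continuous_on_powr' continuous_intros) auto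
  then have "(\<lambda>x. indicator \<Omega> x *\<^sub>R norm (f x) powr p) \<in> borel_measurable lebesgue"
    by (simp add: measurable_completion)
  then have int: "integrable lebesgue (\<lambda>x. indicator \<Omega> x *\<^sub>R norm (f x) powr p)"
    by (rule Bochner_Integration.integrable_bound[OF intB]) (use le in auto)
  then show "f \<in> bergman_space p \<Omega>"
    using f by (simp add: bergman_space_def set_integrable_def)
  have "set_lebesgue_integral lebesgue \<Omega> (\<lambda>z. norm (f z) powr p) \<le> (\<integral>x. B powr p * indicator \<Omega> x \<partial>lebesgue)"
    unfolding set_lebesgue_integral_def using le
    by (intro integral_mono int intB) (auto simp: abs_of_nonneg)
  also have "\<dots> = B powr p * measure lebesgue \<Omega>"
    using lm by simp
  finally have "Lp_norm p \<Omega> f \<le> (B powr p * measure lebesgue \<Omega>) powr (1 / p)"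
    unfolding Lp_norm_def using p
    by (intro powr_mono2) (auto simp: set_lebesgue_integral_def)
  also have "\<dots> = B * measure lebesgue \<Omega> powr (1 / p)"
    using p B(2) by (simp add: powr_mult powr_powr)
  finally show "Lp_norm p \<Omega> f \<le> B * measure lebesgue \<Omega> powr (1 / p)" .
qed

lemma norm_le_sup_norm:
  assumes "bounded (f ` \<Omega>)" "w \<in> \<Omega>"
  shows "norm (f w) \<le> sup_norm \<Omega> f"
proof -
  have "bdd_above ((\<lambda>z. norm (f z)) ` \<Omega>)"
    using assms(1) by (simp add: bdd_above_norm[symmetric] image_image)
  then show ?thesis unfolding sup_norm_def by (rule cSUP_upper[OF assms(2)])
qed

lemma sup_norm_normalize:
  assumes b: "bounded (f ` \<Omega>)" and w: "w \<in> \<Omega>" "f w \<noteq> 0"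
  shows "sup_norm \<Omega> f > 0"
    and "bounded ((\<lambda>u. of_real (1 / sup_norm \<Omega> f) * f u) ` \<Omega>)"
    and "sup_norm \<Omega> (\<lambda>u. of_real (1 / sup_norm \<Omega> f) * f u) = 1"
proof -
  define s where "s = sup_norm \<Omega> f"
  let ?g = "\<lambda>u. of_real (1 / s) * f u"
  have f_le: "norm (f u) \<le> s" if "u \<in> \<Omega>" for u
    unfolding s_def using b that by (rule norm_le_sup_norm)
  have s: "s > 0"
    using f_le[OF w(1)] w(2) by (metis less_le_trans zero_less_norm_iff)
  then show "sup_norm \<Omega> f > 0" by (simp add: s_def)
  have g_le: "norm (?g u) \<le> 1" if "u \<in> \<Omega>" for u
    using f_le[OF that] s by (simp add: norm_mult norm_divide divide_le_eq)
  then have bg: "bounded (?g ` \<Omega>)"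
    unfolding bounded_iff by blast
  then show "bounded ((\<lambda>u. of_real (1 / sup_norm \<Omega> f) * f u) ` \<Omega>)" by (simp only: s_def)
  have "sup_norm \<Omega> ?g \<le> 1"
    unfolding sup_norm_def by (rule cSUP_least) (use w g_le in auto)
  moreover have "(SUP u\<in>\<Omega>. norm (f u)) \<le> s * sup_norm \<Omega> ?g"
  proof (rule cSUP_least)
    fix u assume "u \<in> \<Omega>"
    have "norm (f u) = s * norm (?g u)"
      using s by (simp add: norm_mult norm_divide)
    also have "\<dots> \<le> s * sup_norm \<Omega> ?g"
      using norm_le_sup_norm[OF bg \<open>u \<in> \<Omega>\<close>] s by (intro mult_left_mono) auto
    finally show "norm (f u) \<le> s * sup_norm \<Omega> ?g" .
  qed (use w in auto)
  then have "s \<le> s * sup_norm \<Omega> ?g"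
    unfolding sup_norm_def[of \<Omega> f, folded s_def, symmetric] .
  then have "1 \<le> sup_norm \<Omega> ?g" using s by simp
  ultimately have "sup_norm \<Omega> ?g = 1" by (rule antisym)
  then show "sup_norm \<Omega> (\<lambda>u. of_real (1 / sup_norm \<Omega> f) * f u) = 1" by (simp only: s_def)
qed

lemma vector_deriv_Cauchy_bound:
  assumes f: "holomorphic_Cn f \<Omega>" and r: "r > 0" "ball z r \<subseteq> \<Omega>"
    and M: "\<And>y. y \<in> ball z r \<Longrightarrow> norm (f y) \<le> M"
  shows "norm (vector_deriv X f z) \<le> M / r * norm X"
proof -
  have f': "holomorphic_Cn f (ball z r)" using f r(2) by (rule holomorphic_Cn_subset)
  show ?thesis
    using Cauchy_estimate_frechet[OF f' r(1) M] vector_deriv_eq_frechet_derivative[OF f'] r(1) by simp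
qed

section \<open>The Caratheodory metric\<close>

text \<open>A coordinate function, shifted to vanish at \<open>z\<close> and divided by its sup norm.\<close>
lemma caratheodory_set_nonempty:
  fixes \<Omega> :: "(complex ^ 'n) set"
  assumes \<Omega>: "open \<Omega>" "bounded \<Omega>" and z: "z \<in> \<Omega>"
  shows "\<exists>f. f \<in> bounded_holomorphic \<Omega> \<and> f z = 0 \<and> sup_norm \<Omega> f = 1"
proof -
  fix j :: 'n
  let ?f = "\<lambda>w :: complex ^ 'n. w $ j - z $ j"
  have hol: "holomorphic_Cn ?f \<Omega>"
    unfolding holomorphic_Cn_def
    by (intro ballI exI[of _ "\<lambda>v. v $ j"] conjI)
       (auto intro!: derivative_eq_intros bounded_linear_imp_has_derivative bounded_linear_vec_nth)
  obtain B where B: "\<And>w. w \<in> \<Omega> \<Longrightarrow> norm w \<le> B"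
    using \<Omega>(2) by (auto simp: bounded_iff)
  have bd: "bounded (?f ` \<Omega>)"
    unfolding bounded_iff
  proof (intro exI ballI)
    fix y assume "y \<in> ?f ` \<Omega>"
    then obtain w where w: "w \<in> \<Omega>" "y = w $ j - z $ j" by blast
    have "norm y \<le> norm (w $ j) + norm (z $ j)" unfolding w(2) by (rule norm_triangle_ineq4)
    also have "\<dots> \<le> norm w + norm z" by (intro add_mono Finite_Cartesian_Product.norm_nth_le)
    also have "\<dots> \<le> B + B" by (intro add_mono B w(1) z)
    finally show "norm y \<le> B + B" .
  qed
  obtain r where r: "r > 0" "ball z r \<subseteq> \<Omega>"
    using \<Omega>(1) z by (auto simp: open_contains_ball)
  define w where "w = z + of_real (r / 2) *s axis j 1"
  have "norm (w - z) = r / 2" using r(1) by (simp add: w_def norm_vector_scalar_mult norm_axis_1)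
  then have w: "w \<in> \<Omega>" using r by (auto simp: subset_iff dist_norm norm_minus_commute)
  have fw: "?f w \<noteq> 0" using r(1) by (simp add: w_def axis_def)
  let ?a = "of_real (1 / sup_norm \<Omega> ?f) :: complex"
  show ?thesis
    using sup_norm_normalize[OF bd w fw] holomorphic_Cn_cmult(1)[OF hol, of ?a]
    by (intro exI[of _ "\<lambda>u. ?a * ?f u"]) (simp add: bounded_holomorphic_def)
qed

lemma caratheodory_set_bdd_above:
  assumes \<Omega>: "open \<Omega>" and z: "z \<in> \<Omega>"
  shows "bdd_above {norm (vector_deriv X f z) | f.
           f \<in> bounded_holomorphic \<Omega> \<and> f z = 0 \<and> sup_norm \<Omega> f = 1}"
proof -
  obtain r where r: "r > 0" "ball z r \<subseteq> \<Omega>"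
    using \<Omega> z by (auto simp: open_contains_ball)
  show ?thesis
  proof (rule bdd_aboveI)
    fix y assume "y \<in> {norm (vector_deriv X f z) | f.
           f \<in> bounded_holomorphic \<Omega> \<and> f z = 0 \<and> sup_norm \<Omega> f = 1}"
    then obtain f where f: "y = norm (vector_deriv X f z)" "holomorphic_Cn f \<Omega>" "bounded (f ` \<Omega>)"
      "sup_norm \<Omega> f = 1" by (auto simp: bounded_holomorphic_def)
    show "y \<le> 1 / r * norm X"
      unfolding f(1) using norm_le_sup_norm[OF f(3)] f(4) r
      by (intro vector_deriv_Cauchy_bound[OF f(2)]) auto
  qed
qed

text \<open>Competitors may have sup norm less than one: scaling up to norm one only enlarges the
  derivative. The zero function cannot be scaled, but its derivative vanishes and the metric is
  nonnegative.\<close>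
lemma vector_deriv_le_caratheodory_metric:
  fixes \<Omega> :: "(complex ^ 'n) set"
  assumes \<Omega>: "open \<Omega>" "bounded \<Omega>" and z: "z \<in> \<Omega>"
    and g: "holomorphic_Cn g \<Omega>" "g z = 0" "\<And>w. w \<in> \<Omega> \<Longrightarrow> norm (g w) \<le> 1"
  shows "norm (vector_deriv X g z) \<le> caratheodory_metric \<Omega> z X"
proof -
  note upper = cSup_upper[OF _ caratheodory_set_bdd_above[OF \<Omega>(1) z], folded caratheodory_metric_def]
  have nonneg: "caratheodory_metric \<Omega> z X \<ge> 0"
  proof -
    obtain f where "f \<in> bounded_holomorphic \<Omega>" "f z = 0" "sup_norm \<Omega> f = 1"
      using caratheodory_set_nonempty[OF \<Omega> z] by blast
    then have "norm (vector_deriv X f z) \<le> caratheodory_metric \<Omega> z X" by (intro upper) blast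
    then show ?thesis by (meson norm_ge_zero order_trans)
  qed
  show ?thesis
  proof (cases "\<forall>w\<in>\<Omega>. g w = 0")
    case True
    obtain r where r: "r > 0" "ball z r \<subseteq> \<Omega>"
      using \<Omega>(1) z by (auto simp: open_contains_ball)
    have "norm (vector_deriv X g z) \<le> 0 / r * norm X"
      using True r by (intro vector_deriv_Cauchy_bound[OF g(1)]) auto
    with nonneg show ?thesis by simp
  next
    case False
    then obtain w where w: "w \<in> \<Omega>" "g w \<noteq> 0" by blast
    have bd: "bounded (g ` \<Omega>)" using g(3) unfolding bounded_iff by blast
    let ?s = "sup_norm \<Omega> g"
    let ?g = "\<lambda>u. of_real (1 / ?s) * g u"
    note norm_g = sup_norm_normalize[OF bd w]
    have "?s \<le> 1" unfolding sup_norm_def by (rule cSUP_least) (use w g(3) in auto)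
    have "norm (vector_deriv X ?g z) \<le> caratheodory_metric \<Omega> z X"
      using norm_g(2,3) holomorphic_Cn_cmult(1)[OF g(1)] g(2)
      by (intro upper) (auto simp: bounded_holomorphic_def intro!: exI[of _ ?g])
    moreover have "norm (vector_deriv X ?g z) = norm (vector_deriv X g z) / ?s"
      using norm_g(1) by (simp only: holomorphic_Cn_cmult(2)[OF g(1) z] norm_mult norm_of_real) simp
    moreover have "norm (vector_deriv X g z) \<le> norm (vector_deriv X g z) / ?s"
      using norm_g(1) \<open>?s \<le> 1\<close> by (simp add: le_divide_eq mult_left_le)
    ultimately show ?thesis by linarith
  qed
qed

section \<open>The two factors of the Bergman metric\<close>
definition bergman_derivatives :: "real \<Rightarrow> (complex ^ 'n) set \<Rightarrow> complex ^ 'n \<Rightarrow> complex ^ 'n \<Rightarrow> real set" where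
  "bergman_derivatives p \<Omega> z X =
     {norm (vector_deriv X f z) | f. f \<in> bergman_space p \<Omega> \<and> f z = 0 \<and> Lp_norm p \<Omega> f = 1}"

text \<open>The upper bound is the norm of the constant function \<open>1\<close>; the lower bound is the pointwise bound at
  \<open>z\<close> for functions with value \<open>1\<close> there.\<close>
lemma bergman_min_bounds:
  fixes \<Omega> :: "(complex ^ 'n) set"
  assumes \<Omega>: "open \<Omega>" "bounded \<Omega>" and p: "p \<ge> 1" and r: "r > 0" "ball z r \<subseteq> \<Omega>"
  shows "measure lborel (ball 0 r :: (complex ^ 'n) set) powr (1 / p) \<le> bergman_min p \<Omega> z"
    and "bergman_min p \<Omega> z \<le> measure lebesgue \<Omega> powr (1 / p)"
proof -
  let ?\<mu> = "measure lborel (ball 0 r :: (complex ^ 'n) set)"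
  let ?A = "{Lp_norm p \<Omega> f | f. f \<in> bergman_space p \<Omega> \<and> f z = 1}"
  have \<mu>: "?\<mu> > 0" using content_ball_pos[OF r(1)] .
  have "holomorphic_Cn (\<lambda>_. 1) \<Omega>"
    unfolding holomorphic_Cn_def by (intro ballI exI[of _ "\<lambda>_. 0"]) auto
  note one = bounded_holomorphic_in_bergman_space[OF \<Omega> this, of p 1]
  have one_in: "Lp_norm p \<Omega> (\<lambda>_. 1) \<in> ?A"
    using one(1) p by (intro CollectI exI[of _ "\<lambda>_. 1"]) auto
  have lower: "?\<mu> powr (1 / p) \<le> y" if y: "y \<in> ?A" for y
  proof -
    obtain f where f: "y = Lp_norm p \<Omega> f" "f \<in> bergman_space p \<Omega>" "f z = 1"
      using y by blast
    have "1 \<le> ?\<mu> powr (- 1 / p) * y"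
      using pointwise_bound_bergman[OF f(2) p r] f by simp
    then show ?thesis using \<mu> by (simp add: powr_minus field_simps)
  qed
  show "?\<mu> powr (1 / p) \<le> bergman_min p \<Omega> z"
    unfolding bergman_min_def by (rule cInf_greatest) (use one_in lower in auto)
  have "bergman_min p \<Omega> z \<le> Lp_norm p \<Omega> (\<lambda>_. 1)"
    unfolding bergman_min_def by (rule cInf_lower[OF one_in bdd_belowI[OF lower]])
  also have "\<dots> \<le> measure lebesgue \<Omega> powr (1 / p)"
    using one(2) p by simp
  finally show "bergman_min p \<Omega> z \<le> measure lebesgue \<Omega> powr (1 / p)" .
qed

lemma bergman_metric_eq:
  assumes "bergman_min p \<Omega> z > 0" "p > 0"
  shows "bergman_metric p \<Omega> z X = bergman_min p \<Omega> z * Sup (bergman_derivatives p \<Omega> z X)"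
  using assms by (simp add: bergman_metric_def bergman_kernel_def bergman_derivatives_def powr_powr)

lemma tendsto_powr_inverse_at_top:
  fixes c :: real
  assumes "c > 0"
  shows "((\<lambda>p. c powr (1 / p)) \<longlongrightarrow> 1) at_top"
proof -
  have "((\<lambda>p::real. 1 / p) \<longlongrightarrow> 0) at_top"
    by real_asymp
  then have "((\<lambda>p. c powr (1 / p)) \<longlongrightarrow> c powr 0) at_top"
    using assms by (intro tendsto_intros) auto
  then show ?thesis using assms by simp
qed

lemma measure_lebesgue_open_pos:
  fixes S :: "'a::euclidean_space set"
  assumes S: "open S" "bounded S" "S \<noteq> {}"
  shows "measure lebesgue S > 0"
proof -
  obtain x where "x \<in> S" using S(3) by blast
  then obtain r where r: "r > 0" "ball x r \<subseteq> S"
    using S(1) by (auto simp: open_contains_ball)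
  have "0 < measure lebesgue (ball x r)"
    using content_ball_pos[OF r(1)] by simp
  also have "\<dots> \<le> measure lebesgue S"
    using r(2) S by (intro measure_mono_fmeasurable bounded_set_imp_lmeasurable) auto
  finally show ?thesis .
qed

lemma bergman_min_tendsto_1:
  fixes \<Omega> :: "(complex ^ 'n) set"
  assumes \<Omega>: "open \<Omega>" "bounded \<Omega>" and z: "z \<in> \<Omega>"
  shows "((\<lambda>p. bergman_min p \<Omega> z) \<longlongrightarrow> 1) at_top"
proof -
  obtain r where r: "r > 0" "ball z r \<subseteq> \<Omega>"
    using \<Omega>(1) z by (auto simp: open_contains_ball)
  let ?\<mu> = "measure lborel (ball 0 r :: (complex ^ 'n) set)"
  have \<mu>: "?\<mu> > 0" using content_ball_pos[OF r(1)] .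
  have V: "measure lebesgue \<Omega> > 0"
    using measure_lebesgue_open_pos[OF \<Omega>] z by auto
  show ?thesis
  proof (rule tendsto_sandwich)
    show "((\<lambda>p. ?\<mu> powr (1 / p)) \<longlongrightarrow> 1) at_top" "((\<lambda>p. measure lebesgue \<Omega> powr (1 / p)) \<longlongrightarrow> 1) at_top"
      using tendsto_powr_inverse_at_top \<mu> V by blast+
  qed (use bergman_min_bounds[OF \<Omega> _ r] in \<open>auto intro!: eventually_at_top_linorderI[of 1]\<close>)
qed

text \<open>Halving the radius makes the pointwise bound uniform on a ball about \<open>z\<close>, where Cauchy's estimate
  applies.\<close>
lemma bergman_derivatives_bdd_above:
  fixes \<Omega> :: "(complex ^ 'n) set"
  assumes \<Omega>: "open \<Omega>" and z: "z \<in> \<Omega>" and p: "p \<ge> 1"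
  shows "bdd_above (bergman_derivatives p \<Omega> z X)"
proof -
  obtain R where R: "R > 0" "ball z R \<subseteq> \<Omega>"
    using \<Omega> z by (auto simp: open_contains_ball)
  define r where "r = R / 2"
  have r: "r > 0" "ball z r \<subseteq> \<Omega>" using R by (auto simp: r_def)
  show ?thesis
  proof (rule bdd_aboveI)
    fix y assume "y \<in> bergman_derivatives p \<Omega> z X"
    then obtain f where f: "y = norm (vector_deriv X f z)" "f \<in> bergman_space p \<Omega>" "Lp_norm p \<Omega> f = 1"
      by (auto simp: bergman_derivatives_def)
    have "norm (f w) \<le> measure lborel (ball 0 r :: (complex ^ 'n) set) powr (- 1 / p)" if "w \<in> ball z r" for w
    proof -
      have "ball w r \<subseteq> ball z R"
        using that by (simp add: ball_subset_ball_iff dist_commute r_def)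
      then show ?thesis
        using pointwise_bound_bergman[OF f(2) p r(1), of w] R(2) f(3) by auto
    qed
    then show "y \<le> measure lborel (ball 0 r :: (complex ^ 'n) set) powr (- 1 / p) / r * norm X"
      unfolding f(1) using f(2) r
      by (intro vector_deriv_Cauchy_bound) (auto simp: bergman_space_def)
  qed
qed

text \<open>A competitor for the Caratheodory metric becomes one for the Bergman metric after division by its
  \<open>p\<close>-norm, which is at most \<open>vol \<Omega> powr (1 / p)\<close>.\<close>
lemma Sup_bergman_derivatives_ge:
  fixes \<Omega> :: "(complex ^ 'n) set"
  assumes \<Omega>: "open \<Omega>" "bounded \<Omega>" and z: "z \<in> \<Omega>" and p: "p \<ge> 1"
  shows "bergman_derivatives p \<Omega> z X \<noteq> {}"
    and "caratheodory_metric \<Omega> z X \<le> measure lebesgue \<Omega> powr (1 / p) * Sup (bergman_derivatives p \<Omega> z X)"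
proof -
  let ?V = "measure lebesgue \<Omega> powr (1 / p)"
  have key: "bergman_derivatives p \<Omega> z X \<noteq> {} \<and>
      norm (vector_deriv X f z) \<le> ?V * Sup (bergman_derivatives p \<Omega> z X)"
    if f: "f \<in> bounded_holomorphic \<Omega>" "f z = 0" "sup_norm \<Omega> f = 1" for f
  proof -
    have hol: "holomorphic_Cn f \<Omega>" and le1: "\<And>w. w \<in> \<Omega> \<Longrightarrow> norm (f w) \<le> 1"
      using f norm_le_sup_norm[of f \<Omega>] by (auto simp: bounded_holomorphic_def)
    have fb: "f \<in> bergman_space p \<Omega>" and L: "Lp_norm p \<Omega> f \<le> ?V"
      using bounded_holomorphic_in_bergman_space[OF \<Omega> hol, of p 1] le1 p by auto
    have "\<exists>w\<in>\<Omega>. f w \<noteq> 0"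
    proof (rule ccontr)
      assume "\<not> (\<exists>w\<in>\<Omega>. f w \<noteq> 0)"
      then have "(\<lambda>w. norm (f w)) ` \<Omega> = (\<lambda>w. 0) ` \<Omega>" by (intro image_cong) auto
      also have "\<dots> = {0}" using z by auto
      finally show False using f(3) by (simp add: sup_norm_def)
    qed
    then obtain w where w: "w \<in> \<Omega>" "f w \<noteq> 0" by blast
    obtain r where r: "r > 0" "ball w r \<subseteq> \<Omega>"
      using \<Omega>(1) w(1) by (auto simp: open_contains_ball)
    have Lpos: "Lp_norm p \<Omega> f > 0"
      using pointwise_bound_bergman[OF fb p r] w(2) Lp_norm_nonneg[of p \<Omega> f]
      by (cases "Lp_norm p \<Omega> f = 0") auto
    let ?c = "of_real (1 / Lp_norm p \<Omega> f) :: complex"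
    have nc: "norm ?c = 1 / Lp_norm p \<Omega> f" using Lpos by (simp only: norm_of_real) simp
    have mem: "norm (vector_deriv X (\<lambda>w. ?c * f w) z) \<in> bergman_derivatives p \<Omega> z X"
      unfolding bergman_derivatives_def
      using bergman_space_cmult[OF fb, of ?c] p f(2) nc Lpos by (intro CollectI exI[of _ "\<lambda>w. ?c * f w"]) auto
    have "norm (vector_deriv X f z) / Lp_norm p \<Omega> f = norm (vector_deriv X (\<lambda>w. ?c * f w) z)"
      by (simp only: holomorphic_Cn_cmult(2)[OF hol z] norm_mult nc) simp
    also have "\<dots> \<le> Sup (bergman_derivatives p \<Omega> z X)"
      by (rule cSup_upper[OF mem bergman_derivatives_bdd_above[OF \<Omega>(1) z p]])
    finally have *: "norm (vector_deriv X f z) / Lp_norm p \<Omega> f \<le> Sup (bergman_derivatives p \<Omega> z X)" .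
    then have "norm (vector_deriv X f z) \<le> Lp_norm p \<Omega> f * Sup (bergman_derivatives p \<Omega> z X)"
      using Lpos by (simp add: field_simps)
    also have "\<dots> \<le> ?V * Sup (bergman_derivatives p \<Omega> z X)"
    proof (rule mult_right_mono[OF L])
      show "Sup (bergman_derivatives p \<Omega> z X) \<ge> 0"
        using * Lpos by (meson divide_nonneg_pos norm_ge_zero order_trans)
    qed
    finally show ?thesis using mem by blast
  qed
  show "bergman_derivatives p \<Omega> z X \<noteq> {}"
    using key caratheodory_set_nonempty[OF \<Omega> z] by blast
  show "caratheodory_metric \<Omega> z X \<le> ?V * Sup (bergman_derivatives p \<Omega> z X)"
    unfolding caratheodory_metric_def
    by (rule cSup_least) (use key caratheodory_set_nonempty[OF \<Omega> z] in auto)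
qed

text \<open>A locally uniform limit of functions of \<open>p k\<close>-norm one, with \<open>p k \<longlonglongrightarrow> \<infinity>\<close>, is bounded by \<open>1\<close>: the constants
  in the pointwise bound tend to \<open>1\<close> whatever the radius of the ball.\<close>
lemma bergman_derivatives_limit_le:
  fixes \<Omega> :: "(complex ^ 'n) set" and p :: "nat \<Rightarrow> real"
  assumes \<Omega>: "open \<Omega>" "bounded \<Omega>" and z: "z \<in> \<Omega>"
    and p: "\<And>k. p k \<ge> 1" "filterlim p at_top sequentially"
    and y: "\<And>k. y k \<in> bergman_derivatives (p k) \<Omega> z X" "\<And>k. y k \<ge> b"
  shows "b \<le> caratheodory_metric \<Omega> z X"
proof -
  have "\<forall>k. \<exists>f. y k = norm (vector_deriv X f z) \<and> f \<in> bergman_space (p k) \<Omega> \<and> f z = 0 \<and> Lp_norm (p k) \<Omega> f = 1"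
    using y(1) by (auto simp: bergman_derivatives_def)
  then obtain f where f: "\<And>k. y k = norm (vector_deriv X (f k) z)" "\<And>k. f k \<in> bergman_space (p k) \<Omega>"
      "\<And>k. f k z = 0" "\<And>k. Lp_norm (p k) \<Omega> (f k) = 1"
    by metis
  have hol: "holomorphic_Cn (f k) \<Omega>" for k
    using f(2) by (simp add: bergman_space_def)
  have bound: "norm (f k w) \<le> measure lborel (ball 0 r :: (complex ^ 'n) set) powr (- 1 / p k)"
    if "r > 0" "ball w r \<subseteq> \<Omega>" for k w r
    using pointwise_bound_bergman[OF f(2) p(1) that] f(4) by simp
  have loc: "\<exists>r>0. \<exists>M. ball w r \<subseteq> \<Omega> \<and> (\<forall>k. \<forall>u\<in>ball w r. norm (f k u) \<le> M)" if w: "w \<in> \<Omega>" for w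
  proof -
    obtain R where R: "R > 0" "ball w R \<subseteq> \<Omega>"
      using \<Omega>(1) w by (auto simp: open_contains_ball)
    define r where "r = R / 2"
    have r: "r > 0" "ball w r \<subseteq> \<Omega>" using R by (auto simp: r_def)
    let ?\<mu> = "measure lborel (ball 0 r :: (complex ^ 'n) set)"
    have \<mu>: "?\<mu> > 0" using content_ball_pos[OF r(1)] .
    \<comment> \<open>The maximum with \<open>1\<close> bounds all powers with exponent \<open>1 / p k \<le> 1\<close>, uniformly in \<open>k\<close>.\<close>
    have "norm (f k u) \<le> max 1 (1 / ?\<mu>)" if "u \<in> ball w r" for k u
    proof -
      have "ball u r \<subseteq> ball w R"
        using that by (simp add: ball_subset_ball_iff dist_commute r_def)
      then have "norm (f k u) \<le> ?\<mu> powr (- 1 / p k)"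
        using bound[OF r(1), of u k] R(2) by blast
      also have "\<dots> = (1 / ?\<mu>) powr (1 / p k)"
        using \<mu> by (simp add: powr_minus powr_divide field_simps)
      also have "\<dots> \<le> max 1 (1 / ?\<mu>) powr (1 / p k)"
        using \<mu> p(1)[of k] by (intro powr_mono2) auto
      also have "\<dots> \<le> max 1 (1 / ?\<mu>) powr 1"
        using p(1)[of k] by (intro powr_mono) auto
      finally show ?thesis by simp
    qed
    then show ?thesis using r by blast
  qed
  obtain g s where s: "strict_mono (s :: nat \<Rightarrow> nat)" and g: "holomorphic_Cn g \<Omega>"
    "\<And>x. x \<in> \<Omega> \<Longrightarrow> (\<lambda>k. f (s k) x) \<longlonglongrightarrow> g x"
    "\<And>x v. x \<in> \<Omega> \<Longrightarrow> (\<lambda>k. frechet_derivative (f (s k)) (at x) v) \<longlonglongrightarrow> frechet_derivative g (at x) v"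
    by (rule Montel_Cn[OF hol loc]) blast+
  have ps: "filterlim (\<lambda>k. p (s k)) at_top sequentially"
    by (rule filterlim_compose[OF p(2) filterlim_subseq[OF s]])
  have "g z = 0"
    using LIMSEQ_unique[OF g(2)[OF z]] f(3) by simp
  moreover have "norm (g w) \<le> 1" if w: "w \<in> \<Omega>" for w
  proof -
    obtain r where r: "r > 0" "ball w r \<subseteq> \<Omega>"
      using \<Omega>(1) w by (auto simp: open_contains_ball)
    let ?\<mu> = "measure lborel (ball 0 r :: (complex ^ 'n) set)"
    have \<mu>: "?\<mu> > 0" using content_ball_pos[OF r(1)] .
    have "(\<lambda>k. inverse (?\<mu> powr (1 / p (s k)))) \<longlonglongrightarrow> inverse 1"
      by (intro tendsto_inverse filterlim_compose[OF tendsto_powr_inverse_at_top[OF \<mu>] ps]) simp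
    then have "(\<lambda>k. ?\<mu> powr (- 1 / p (s k))) \<longlonglongrightarrow> 1"
      by (simp add: powr_minus)
    then show ?thesis
      using bound[OF r] by (intro LIMSEQ_le[OF tendsto_norm[OF g(2)[OF w]]]) auto
  qed
  ultimately have "norm (vector_deriv X g z) \<le> caratheodory_metric \<Omega> z X"
    by (intro vector_deriv_le_caratheodory_metric[OF \<Omega> z g(1)])
  moreover have "b \<le> norm (vector_deriv X g z)"
  proof (rule LIMSEQ_le_const)
    show "(\<lambda>k. norm (vector_deriv X (f (s k)) z)) \<longlonglongrightarrow> norm (vector_deriv X g z)"
      unfolding vector_deriv_eq_frechet_derivative[OF hol z] vector_deriv_eq_frechet_derivative[OF g(1) z]
      by (intro tendsto_norm g(3) z)
  qed (use y(2) f(1) in auto)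
  ultimately show ?thesis by simp
qed

lemma Sup_bergman_derivatives_tendsto:
  fixes \<Omega> :: "(complex ^ 'n) set"
  assumes \<Omega>: "open \<Omega>" "bounded \<Omega>" and z: "z \<in> \<Omega>"
  shows "((\<lambda>p. Sup (bergman_derivatives p \<Omega> z X)) \<longlongrightarrow> caratheodory_metric \<Omega> z X) at_top"
proof (rule order_tendstoI)
  let ?C = "caratheodory_metric \<Omega> z X"
  have V: "measure lebesgue \<Omega> > 0"
    using measure_lebesgue_open_pos[OF \<Omega>] z by auto
  fix a assume a: "a < ?C"
  have "((\<lambda>p. ?C / measure lebesgue \<Omega> powr (1 / p)) \<longlongrightarrow> ?C / 1) at_top"
    by (intro tendsto_divide tendsto_const tendsto_powr_inverse_at_top[OF V]) simp
  then have "\<forall>\<^sub>F p in at_top. a < ?C / measure lebesgue \<Omega> powr (1 / p)"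
    using a by (intro order_tendstoD(1)) auto
  then show "\<forall>\<^sub>F p in at_top. a < Sup (bergman_derivatives p \<Omega> z X)"
    using eventually_ge_at_top[of 1]
  proof eventually_elim
    case (elim p)
    have "?C / measure lebesgue \<Omega> powr (1 / p) \<le> Sup (bergman_derivatives p \<Omega> z X)"
      using Sup_bergman_derivatives_ge(2)[OF \<Omega> z elim(2), of X] V by (simp add: field_simps)
    with elim(1) show ?case by simp
  qed
next
  let ?C = "caratheodory_metric \<Omega> z X"
  fix a assume a: "?C < a"
  then obtain b where b: "?C < b" "b < a" using dense by blast
  show "\<forall>\<^sub>F p in at_top. Sup (bergman_derivatives p \<Omega> z X) < a"
  proof (rule ccontr)
    assume neg: "\<not> (\<forall>\<^sub>F p in at_top. Sup (bergman_derivatives p \<Omega> z X) < a)"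
    have "\<exists>p y. p \<ge> real k + 1 \<and> y \<in> bergman_derivatives p \<Omega> z X \<and> y \<ge> b" for k
    proof -
      obtain p where p: "p \<ge> real k + 1" "a \<le> Sup (bergman_derivatives p \<Omega> z X)"
        using neg unfolding eventually_at_top_linorder by (meson not_less)
      then have "p \<ge> 1" by linarith
      have "b < Sup (bergman_derivatives p \<Omega> z X)" using p(2) b(2) by simp
      then obtain y where "y \<in> bergman_derivatives p \<Omega> z X" "b < y"
        using less_cSupD[OF Sup_bergman_derivatives_ge(1)[OF \<Omega> z \<open>p \<ge> 1\<close>]] by blast
      with p(1) show ?thesis by (meson less_imp_le)
    qed
    then obtain p y where py: "\<And>k. p k \<ge> real k + 1" "\<And>k. y k \<in> bergman_derivatives (p k) \<Omega> z X" "\<And>k. y k \<ge> b"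
      by metis
    have "filterlim p at_top sequentially"
    proof (rule filterlim_at_top_mono[OF filterlim_real_sequentially])
      show "\<forall>\<^sub>F k in sequentially. real k \<le> p k"
        using py(1) by (intro always_eventually allI) (smt (verit))
    qed
    moreover have "p k \<ge> 1" for k using py(1)[of k] by linarith
    ultimately have "b \<le> ?C" using py by (intro bergman_derivatives_limit_le[OF \<Omega> z])
    with b(1) show False by simp
  qed
qed

theorem proposition1p4:
  fixes \<Omega> :: "(complex ^ 'n) set" and z X :: "complex ^ 'n"
  assumes "open \<Omega>" and "connected \<Omega>" and "bounded \<Omega>" and "z \<in> \<Omega>"
  shows "((\<lambda>p::real. bergman_metric p \<Omega> z X) \<longlongrightarrow> caratheodory_metric \<Omega> z X) at_top"
proof -
  have m: "((\<lambda>p. bergman_min p \<Omega> z) \<longlongrightarrow> 1) at_top"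
    using assms by (intro bergman_min_tendsto_1)
  have "((\<lambda>p. bergman_min p \<Omega> z * Sup (bergman_derivatives p \<Omega> z X)) \<longlongrightarrow>
      1 * caratheodory_metric \<Omega> z X) at_top"
    using assms by (intro tendsto_mult m Sup_bergman_derivatives_tendsto)
  moreover have "\<forall>\<^sub>F p in at_top. bergman_min p \<Omega> z * Sup (bergman_derivatives p \<Omega> z X) = bergman_metric p \<Omega> z X"
    using order_tendstoD(1)[OF m zero_less_one] eventually_gt_at_top[of 0]
    by eventually_elim (simp add: bergman_metric_eq)
  ultimately have "((\<lambda>p. bergman_metric p \<Omega> z X) \<longlongrightarrow> 1 * caratheodory_metric \<Omega> z X) at_top"
    by (rule Lim_transform_eventually)
  then show ?thesis by simp
qed

end
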